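(* Let $(A,p_l)$ be a Fréchet algebra with a bounded approximate identity. Then for each $n\in\mathbb{N}$, the Fréchet algebra $A^{\#}$ is $2n$-weakly amenable if and only if $A$ is $2n$-weakly amenable.
   Context: All spaces are complex and $\mathbb{N}=\{1,2,\dots\}$. A Fréchet algebra $(A,p_l)$ is an algebra that is complete and Hausdorff for the topology generated by a separating, increasing sequence $(p_l)_{l\in\mathbb{N}}$ of submultiplicative seminorms. A bounded approximate identity is a bounded net $(e_\alpha)$ in $A$ with $e_\alpha a\to a$ and $ae_\alpha\to a$ for all $a\in A$. The unitization of $A$ is $A^{\#}=A\oplus\mathbb{C}e$ with product $(a,\lambda)(b,\mu)=(ab+\mu a+\lambda b,\lambda\mu)$ and seminorms $q_l(a,\lambda)=p_l(a)+|\lambda|$; it is a Fréchet algebra with identity $e=(0,1)$. For a locally convex space $X$, $X^*$ is its continuous dual with the strong topology (uniform convergence on bounded subsets of $X$); $X^{(0)}=X$ and $X^{(n)}=(X^{(n-1)})^*$. If $B$ is a Fréchet algebra and $X$ a locally convex $B$-bimodule, then $X^*$ is a $B$-bimodule via $\langle b\cdot f,x\rangle=\langle f,x\cdot b\rangle$ and $\langle f\cdot b,x\rangle=\langle f,b\cdot x\rangle$; iterating, every $X^{(n)}$ is a $B$-bimodule. $B$ is a bimodule over itself by multiplication. A continuous derivation $D:B\to X$ is a continuous linear map with $D(ab)=a\cdot D(b)+D(a)\cdot b$ for all $a,b\in B$; it is inner if there is $x\in X$ with $D(b)=b\cdot x-x\cdot b$ for all $b\in B$. $B$ is $n$-weakly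 amenable if every continuous derivation $B\to B^{(n)}$ is inner. *)

theory Defs
  imports "HOL-Analysis.Analysis" "HOL-Algebra.Module" "HOL-Algebra.Algebraic_Closure_Type"
begin

text \<open>
  Algebras and bimodules are records over a carrier set, extending the record of
  modules over the field of complex numbers, \<open>ring_of_type_algebra :: complex ring\<close>.
  That record also has fields \<open>mult\<close> and \<open>one\<close>: algebras use \<open>mult\<close>, but not \<open>one\<close>
  (they need not be unital), and bimodules use neither.
\<close>

record 'a frechet = "(complex, 'a) module" +
  pnorm :: "nat \<Rightarrow> 'a \<Rightarrow> real"

record ('b, 'x) bimodule = "(complex, 'x) module" +
  seminorms :: "('x \<Rightarrow> real) set"
  lact :: "'b \<Rightarrow> 'x \<Rightarrow> 'x"
  ract :: "'x \<Rightarrow> 'b \<Rightarrow> 'x"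


subsection \<open>Locally convex spaces\<close>

definition seminorm_on :: "(complex, 'x, 'm) module_scheme \<Rightarrow> ('x \<Rightarrow> real) \<Rightarrow> bool" where
  "seminorm_on M p \<longleftrightarrow>
     (\<forall>x\<in>carrier M. 0 \<le> p x) \<and>
     (\<forall>x\<in>carrier M. \<forall>y\<in>carrier M. p (x \<oplus>\<^bsub>M\<^esub> y) \<le> p x + p y) \<and>
     (\<forall>z. \<forall>x\<in>carrier M. p (z \<odot>\<^bsub>M\<^esub> x) = cmod z * p x)"

text \<open>The open balls of the single seminorms form a subbase. The carrier is added to it only
  so that the underlying set is right when \<open>P\<close> is empty.\<close>

definition lc_topology :: "(complex, 'x, 'm) module_scheme \<Rightarrow> ('x \<Rightarrow> real) set \<Rightarrow> 'x topology" where
  "lc_topology M P = topology_generated_by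
     (insert (carrier M)
       {{y \<in> carrier M. p (y \<ominus>\<^bsub>M\<^esub> x) < r} | p x r. p \<in> P \<and> x \<in> carrier M \<and> 0 < r})"

definition lc_bounded ::
    "(complex, 'x, 'm) module_scheme \<Rightarrow> ('x \<Rightarrow> real) set \<Rightarrow> 'x set \<Rightarrow> bool" where
  "lc_bounded M P S \<longleftrightarrow> S \<subseteq> carrier M \<and> (\<forall>p\<in>P. bdd_above (p ` S))"

text \<open>Completeness of the uniform structure: every Cauchy filter (equivalently, net) on the
  carrier converges.\<close>

definition lc_complete :: "(complex, 'x, 'm) module_scheme \<Rightarrow> ('x \<Rightarrow> real) set \<Rightarrow> bool" where
  "lc_complete M P \<longleftrightarrow>
     (\<forall>F. F \<noteq> bot \<and> F \<le> principal (carrier M) \<and>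
        (\<forall>p\<in>P. \<forall>r>0. \<forall>\<^sub>F z in F \<times>\<^sub>F F. p (fst z \<ominus>\<^bsub>M\<^esub> snd z) < r) \<longrightarrow>
        (\<exists>x. limitin (lc_topology M P) (\<lambda>y. y) x F))"


subsection \<open>Frechet algebras\<close>

text \<open>The index set of the seminorms starts at 0 instead of 1. Since the seminorms separate
  points, the topology is Hausdorff.\<close>

locale frechet_algebra =
  Module.module "ring_of_type_algebra :: complex ring" A for A :: "'a frechet" (structure) +
  assumes mult_closed: "\<lbrakk>a \<in> carrier A; b \<in> carrier A\<rbrakk> \<Longrightarrow> a \<otimes> b \<in> carrier A"
    and mult_assoc: "\<lbrakk>a \<in> carrier A; b \<in> carrier A; c \<in> carrier A\<rbrakk> \<Longrightarrow>
      (a \<otimes> b) \<otimes> c = a \<otimes> (b \<otimes> c)"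
    and mult_add_left: "\<lbrakk>a \<in> carrier A; b \<in> carrier A; c \<in> carrier A\<rbrakk> \<Longrightarrow>
      (a \<oplus> b) \<otimes> c = (a \<otimes> c) \<oplus> (b \<otimes> c)"
    and mult_add_right: "\<lbrakk>a \<in> carrier A; b \<in> carrier A; c \<in> carrier A\<rbrakk> \<Longrightarrow>
      a \<otimes> (b \<oplus> c) = (a \<otimes> b) \<oplus> (a \<otimes> c)"
    and mult_smult_left: "\<lbrakk>a \<in> carrier A; b \<in> carrier A\<rbrakk> \<Longrightarrow>
      (z \<odot> a) \<otimes> b = z \<odot> (a \<otimes> b)"
    and mult_smult_right: "\<lbrakk>a \<in> carrier A; b \<in> carrier A\<rbrakk> \<Longrightarrow>
      a \<otimes> (z \<odot> b) = z \<odot> (a \<otimes> b)"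
    and pnorm_seminorm: "seminorm_on A (pnorm A l)"
    and pnorm_submultiplicative: "\<lbrakk>a \<in> carrier A; b \<in> carrier A\<rbrakk> \<Longrightarrow>
      pnorm A l (a \<otimes> b) \<le> pnorm A l a * pnorm A l b"
    and pnorm_increasing: "a \<in> carrier A \<Longrightarrow> pnorm A l a \<le> pnorm A (Suc l) a"
    and pnorm_separating: "\<lbrakk>a \<in> carrier A; \<And>l. pnorm A l a = 0\<rbrakk> \<Longrightarrow> a = \<zero>"
    and complete: "lc_complete A (range (pnorm A))"

definition directed_set :: "'i set \<Rightarrow> ('i \<Rightarrow> 'i \<Rightarrow> bool) \<Rightarrow> bool" where
  "directed_set I R \<longleftrightarrow> I \<noteq> {} \<and> reflp_on I R \<and> transp_on I R \<and>
     (\<forall>i\<in>I. \<forall>j\<in>I. \<exists>k\<in>I. R i k \<and> R j k)"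

definition net_filter :: "'i set \<Rightarrow> ('i \<Rightarrow> 'i \<Rightarrow> bool) \<Rightarrow> 'i filter" where
  "net_filter I R = (INF i\<in>I. principal {j \<in> I. R i j})"

definition bounded_approximate_identity ::
    "'a frechet \<Rightarrow> 'i set \<Rightarrow> ('i \<Rightarrow> 'i \<Rightarrow> bool) \<Rightarrow> ('i \<Rightarrow> 'a) \<Rightarrow> bool" where
  "bounded_approximate_identity A I R e \<longleftrightarrow>
     directed_set I R \<and>
     lc_bounded A (range (pnorm A)) (e ` I) \<and>
     (\<forall>a\<in>carrier A.
        limitin (lc_topology A (range (pnorm A))) (\<lambda>i. e i \<otimes>\<^bsub>A\<^esub> a) a (net_filter I R) \<and>
        limitin (lc_topology A (range (pnorm A))) (\<lambda>i. a \<otimes>\<^bsub>A\<^esub> e i) a (net_filter I R))"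

definition unitization :: "'a frechet \<Rightarrow> ('a \<times> complex) frechet" where
  "unitization A = \<lparr>
     carrier = carrier A \<times> UNIV,
     mult = (\<lambda>(a, z) (b, w). ((a \<otimes>\<^bsub>A\<^esub> b) \<oplus>\<^bsub>A\<^esub> (w \<odot>\<^bsub>A\<^esub> a) \<oplus>\<^bsub>A\<^esub> (z \<odot>\<^bsub>A\<^esub> b), z * w)),
     one = (\<zero>\<^bsub>A\<^esub>, 1),
     zero = (\<zero>\<^bsub>A\<^esub>, 0),
     add = (\<lambda>(a, z) (b, w). (a \<oplus>\<^bsub>A\<^esub> b, z + w)),
     smult = (\<lambda>u (a, z). (u \<odot>\<^bsub>A\<^esub> a, u * z)),
     pnorm = (\<lambda>l (a, z). pnorm A l a + cmod z)\<rparr>"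


subsection \<open>Iterated strong duals\<close>

definition self_bimodule :: "'a frechet \<Rightarrow> ('a, 'a) bimodule" where
  "self_bimodule B = \<lparr>
     carrier = carrier B, mult = mult B, one = one B, zero = zero B, add = add B,
     smult = smult B, seminorms = range (pnorm B), lact = mult B, ract = mult B\<rparr>"

abbreviation bimod_topology :: "('b, 'x) bimodule \<Rightarrow> 'x topology" where
  "bimod_topology E \<equiv> lc_topology E (seminorms E)"

definition functionals :: "('b, 'x) bimodule \<Rightarrow> ('x \<Rightarrow> complex) set" where
  "functionals E = {f \<in> extensional (carrier E).
     (\<forall>x\<in>carrier E. \<forall>y\<in>carrier E. f (x \<oplus>\<^bsub>E\<^esub> y) = f x + f y) \<and>
     (\<forall>z. \<forall>x\<in>carrier E. f (z \<odot>\<^bsub>E\<^esub> x) = z * f x) \<and>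
     continuous_map (bimod_topology E) euclidean f}"

text \<open>
  The functionals on the \<open>n\<close>-th dual have a type that grows with \<open>n\<close>, so that no single type can
  hold all of them literally. To let \<open>n\<close> be a variable, functionals are represented by elements
  of a type \<open>'u\<close>: a coding \<open>\<kappa>\<close>, injective on the functionals of \<open>E\<close>, names the functional \<open>f\<close> by
  \<open>\<kappa> f\<close>, and \<open>apply_code \<kappa> E\<close> recovers \<open>f\<close> from its name. All operations on
  \<open>dual \<kappa> E\<close> are the pointwise ones on the named functionals, and the seminorms
  \<open>f \<mapsto> sup {|f x| | x \<in> S}\<close>, for \<open>S\<close> bounded, give the strong topology.
\<close>

definition apply_code :: "(('x \<Rightarrow> complex) \<Rightarrow> 'u) \<Rightarrow> ('b, 'x) bimodule \<Rightarrow> 'u \<Rightarrow> 'x \<Rightarrow> complex" where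
  "apply_code \<kappa> E = inv_into (functionals E) \<kappa>"

definition dual :: "(('x \<Rightarrow> complex) \<Rightarrow> 'u) \<Rightarrow> ('b, 'x) bimodule \<Rightarrow> ('b, 'u) bimodule" where
  "dual \<kappa> E = \<lparr>
     carrier = \<kappa> ` functionals E,
     mult = undefined,
     one = undefined,
     zero = \<kappa> (\<lambda>x\<in>carrier E. 0),
     add = (\<lambda>f g. \<kappa> (\<lambda>x\<in>carrier E. apply_code \<kappa> E f x + apply_code \<kappa> E g x)),
     smult = (\<lambda>z f. \<kappa> (\<lambda>x\<in>carrier E. z * apply_code \<kappa> E f x)),
     seminorms = {\<lambda>f. SUP x\<in>S. cmod (apply_code \<kappa> E f x) | S.
       S \<noteq> {} \<and> lc_bounded E (seminorms E) S},
     lact = (\<lambda>b f. \<kappa> (\<lambda>x\<in>carrier E. apply_code \<kappa> E f (ract E x b))),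
     ract = (\<lambda>f b. \<kappa> (\<lambda>x\<in>carrier E. apply_code \<kappa> E f (lact E b x)))\<rparr>"

text \<open>The \<open>n\<close>-th dual for \<open>n \<ge> 1\<close>; \<open>E\<close> itself, in general of another type, is not covered. The
  coding \<open>\<kappa>\<^sub>0\<close> is for functionals on \<open>E\<close>, and \<open>\<kappa> n\<close> for those on the \<open>n\<close>-th dual.\<close>

fun nth_dual ::
    "(('x \<Rightarrow> complex) \<Rightarrow> 'u) \<Rightarrow> (nat \<Rightarrow> ('u \<Rightarrow> complex) \<Rightarrow> 'u) \<Rightarrow>
     ('b, 'x) bimodule \<Rightarrow> nat \<Rightarrow> ('b, 'u) bimodule" where
  "nth_dual \<kappa>\<^sub>0 \<kappa> E (Suc 0) = dual \<kappa>\<^sub>0 E"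
| "nth_dual \<kappa>\<^sub>0 \<kappa> E (Suc (Suc n)) = dual (\<kappa> (Suc n)) (nth_dual \<kappa>\<^sub>0 \<kappa> E (Suc n))"

definition codes_duals ::
    "(('x \<Rightarrow> complex) \<Rightarrow> 'u) \<Rightarrow> (nat \<Rightarrow> ('u \<Rightarrow> complex) \<Rightarrow> 'u) \<Rightarrow>
     ('b, 'x) bimodule \<Rightarrow> nat \<Rightarrow> bool" where
  "codes_duals \<kappa>\<^sub>0 \<kappa> E n \<longleftrightarrow>
     inj_on \<kappa>\<^sub>0 (functionals E) \<and>
     (\<forall>m. 1 \<le> m \<and> m < n \<longrightarrow> inj_on (\<kappa> m) (functionals (nth_dual \<kappa>\<^sub>0 \<kappa> E m)))"

text \<open>For each fixed \<open>n\<close> there are a type \<open>'u\<close> and codings that work for all bimodules over a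
  given type: it suffices that \<open>'u\<close> contains the first \<open>n\<close> full function spaces \<open>U m\<close> iterated
  over it.\<close>

lemma codes_duals_if_function_tower:
  fixes E :: "('b, 'x) bimodule" and \<kappa>\<^sub>0 :: "('x \<Rightarrow> complex) \<Rightarrow> 'u"
  assumes "inj \<kappa>\<^sub>0" "range \<kappa>\<^sub>0 \<subseteq> U 1"
    and inj: "\<And>m. \<lbrakk>1 \<le> m; m < n\<rbrakk> \<Longrightarrow> inj_on (\<kappa> m) (extensional (U m))"
    and img: "\<And>m. \<lbrakk>1 \<le> m; m < n\<rbrakk> \<Longrightarrow> \<kappa> m ` extensional (U m) \<subseteq> U (Suc m)"
  shows "codes_duals \<kappa>\<^sub>0 \<kappa> E n"
proof -
  have ext: "functionals Y \<subseteq> extensional V" if "carrier Y \<subseteq> V" for V and Y :: "('b, 'u) bimodule"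
    using that by (auto simp: functionals_def extensional_def)
  have sub: "carrier (nth_dual \<kappa>\<^sub>0 \<kappa> E (Suc m)) \<subseteq> U (Suc m)" if "m < n" for m
    using that
  proof (induction m)
    case 0
    then show ?case using assms(2) by (auto simp: dual_def)
  next
    case (Suc m)
    then have "functionals (nth_dual \<kappa>\<^sub>0 \<kappa> E (Suc m)) \<subseteq> extensional (U (Suc m))"
      by (intro ext) simp
    with img[of "Suc m"] Suc.prems show ?case by (auto simp: dual_def)
  qed
  have "inj_on (\<kappa> m) (functionals (nth_dual \<kappa>\<^sub>0 \<kappa> E m))" if "1 \<le> m" "m < n" for m
    using inj_on_subset[OF inj[OF that] ext] sub[of "m - 1"] that by simp
  then show ?thesis
    using inj_on_subset[OF assms(1) subset_UNIV] by (simp add: codes_duals_def)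
qed

lemma codes_second_dual:
  "\<exists>(\<kappa>\<^sub>0 :: ('x \<Rightarrow> complex) \<Rightarrow> ('x \<Rightarrow> complex) + (('x \<Rightarrow> complex) \<Rightarrow> complex)) \<kappa>.
     codes_duals \<kappa>\<^sub>0 \<kappa> (E :: ('b, 'x) bimodule) 2"
proof (intro exI)
  let ?U = "\<lambda>m. if m = 1 then range Inl else range Inr"
  show "codes_duals Inl (\<lambda>_ f. Inr (f \<circ> Inl)) E 2"
  proof (rule codes_duals_if_function_tower[where U = ?U])
    fix m :: nat assume "1 \<le> m" "m < 2"
    then have m: "m = 1" by simp
    show "inj_on (\<lambda>f. Inr (f \<circ> Inl)) (extensional (?U m))"
      unfolding m by (rule inj_onI) (rule extensionalityI[where A = "range Inl"], auto simp: fun_eq_iff)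
    show "(\<lambda>f. Inr (f \<circ> Inl)) ` extensional (?U m) \<subseteq> ?U (Suc m)"
      using m by auto
  qed auto
qed


subsection \<open>Weak amenability\<close>

definition continuous_derivation ::
    "'b frechet \<Rightarrow> ('b, 'x) bimodule \<Rightarrow> ('b \<Rightarrow> 'x) \<Rightarrow> bool" where
  "continuous_derivation B E D \<longleftrightarrow>
     D \<in> carrier B \<rightarrow> carrier E \<and>
     (\<forall>a\<in>carrier B. \<forall>b\<in>carrier B. D (a \<oplus>\<^bsub>B\<^esub> b) = D a \<oplus>\<^bsub>E\<^esub> D b) \<and>
     (\<forall>z. \<forall>a\<in>carrier B. D (z \<odot>\<^bsub>B\<^esub> a) = z \<odot>\<^bsub>E\<^esub> D a) \<and>
     continuous_map (lc_topology B (range (pnorm B))) (bimod_topology E) D \<and>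
     (\<forall>a\<in>carrier B. \<forall>b\<in>carrier B.
        D (a \<otimes>\<^bsub>B\<^esub> b) = lact E a (D b) \<oplus>\<^bsub>E\<^esub> ract E (D a) b)"

definition inner_derivation ::
    "'b frechet \<Rightarrow> ('b, 'x) bimodule \<Rightarrow> ('b \<Rightarrow> 'x) \<Rightarrow> bool" where
  "inner_derivation B E D \<longleftrightarrow>
     (\<exists>x\<in>carrier E. \<forall>b\<in>carrier B. D b = lact E b x \<ominus>\<^bsub>E\<^esub> ract E x b)"

text \<open>Meaningful when \<open>n \<ge> 1\<close> and \<open>codes_duals \<kappa>\<^sub>0 \<kappa> (self_bimodule B) n\<close>; then the choice of
  codings does not matter, since it affects the \<open>n\<close>-th dual only up to isomorphism.\<close>

definition n_weakly_amenable ::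
    "(('b \<Rightarrow> complex) \<Rightarrow> 'u) \<Rightarrow> (nat \<Rightarrow> ('u \<Rightarrow> complex) \<Rightarrow> 'u) \<Rightarrow> nat \<Rightarrow> 'b frechet \<Rightarrow> bool" where
  "n_weakly_amenable \<kappa>\<^sub>0 \<kappa> n B \<longleftrightarrow>
     (\<forall>D. continuous_derivation B (nth_dual \<kappa>\<^sub>0 \<kappa> (self_bimodule B) n) D \<longrightarrow>
          inner_derivation B (nth_dual \<kappa>\<^sub>0 \<kappa> (self_bimodule B) n) D)"

end

theory Submission
  imports Defs
begin

text \<open>
  By induction, the \<open>m\<close>-th dual \<open>F\<close> of \<open>A\<^sup>#\<close> splits topologically as \<open>E \<oplus> \<complex> c\<close>, where \<open>E\<close> is the
  \<open>m\<close>-th dual of \<open>A\<close>. For even \<open>m\<close> the actions of \<open>A\<close> on \<open>F\<close> restrict to those on \<open>E\<close>, the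
  vector \<open>c\<close> commutes with \<open>A\<close>, and \<open>A \<cdot> F\<close> and \<open>F \<cdot> A\<close> have no component along \<open>c\<close>. A
  derivation \<open>A \<rightarrow> E\<close> extends to \<open>A\<^sup>#\<close> by \<open>0\<close> on the unit. Conversely, the component along \<open>c\<close>
  of a continuous derivation \<open>A\<^sup># \<rightarrow> F\<close> vanishes on products in \<open>A\<close>, hence on \<open>A\<close> by the
  approximate identity, so the derivation comes from one of \<open>A\<close> into \<open>E\<close>. Since \<open>c\<close> commutes
  with \<open>A\<close>, inner derivations correspond to inner derivations.
\<close>

subsection \<open>Locally convex spaces\<close>

lemma ring_of_complex_simps:
  "carrier (ring_of_type_algebra :: complex ring) = UNIV"
  "\<one>\<^bsub>(ring_of_type_algebra :: complex ring)\<^esub> = 1"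
  "\<zero>\<^bsub>(ring_of_type_algebra :: complex ring)\<^esub> = 0"
  "z \<oplus>\<^bsub>(ring_of_type_algebra :: complex ring)\<^esub> w = z + w"
  "z \<otimes>\<^bsub>(ring_of_type_algebra :: complex ring)\<^esub> w = z * w"
  by (simp_all add: ring_of_type_algebra_def)

text \<open>The inverse of \<open>x\<close> is asked for as \<open>(-1) \<odot> x\<close>, so every
  condition is a closure property or an identity; in a dual, such identities can be checked value by
  value.\<close>

lemma complex_moduleI:
  fixes M :: "(complex, 'x, 'm) module_scheme" (structure)
  assumes "\<And>x y. \<lbrakk>x \<in> carrier M; y \<in> carrier M\<rbrakk> \<Longrightarrow> x \<oplus> y \<in> carrier M"
    and "\<zero> \<in> carrier M"
    and "\<And>x y z. \<lbrakk>x \<in> carrier M; y \<in> carrier M; z \<in> carrier M\<rbrakk> \<Longrightarrow> (x \<oplus> y) \<oplus> z = x \<oplus> (y \<oplus> z)"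
    and "\<And>x y. \<lbrakk>x \<in> carrier M; y \<in> carrier M\<rbrakk> \<Longrightarrow> x \<oplus> y = y \<oplus> x"
    and "\<And>x. x \<in> carrier M \<Longrightarrow> \<zero> \<oplus> x = x"
    and "\<And>x. x \<in> carrier M \<Longrightarrow> ((-1) \<odot>\<^bsub>M\<^esub> x) \<oplus> x = \<zero>"
    and "\<And>z x. x \<in> carrier M \<Longrightarrow> z \<odot>\<^bsub>M\<^esub> x \<in> carrier M"
    and "\<And>z w x. x \<in> carrier M \<Longrightarrow> (z + w) \<odot>\<^bsub>M\<^esub> x = z \<odot>\<^bsub>M\<^esub> x \<oplus> w \<odot>\<^bsub>M\<^esub> x"
    and "\<And>z x y. \<lbrakk>x \<in> carrier M; y \<in> carrier M\<rbrakk> \<Longrightarrow> z \<odot>\<^bsub>M\<^esub> (x \<oplus> y) = z \<odot>\<^bsub>M\<^esub> x \<oplus> z \<odot>\<^bsub>M\<^esub> y"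
    and "\<And>z w x. x \<in> carrier M \<Longrightarrow> (z * w) \<odot>\<^bsub>M\<^esub> x = z \<odot>\<^bsub>M\<^esub> (w \<odot>\<^bsub>M\<^esub> x)"
    and "\<And>x. x \<in> carrier M \<Longrightarrow> 1 \<odot>\<^bsub>M\<^esub> x = x"
  shows "Module.module (ring_of_type_algebra :: complex ring) M"
proof (rule moduleI)
  show "cring (ring_of_type_algebra :: complex ring)"
    by (rule cring_from_type_algebra)
  show "abelian_group M"
  proof (rule abelian_groupI)
    fix x assume "x \<in> carrier M"
    then show "\<exists>y\<in>carrier M. y \<oplus> x = \<zero>"
      using assms(6,7) by blast
  qed (use assms in auto)
qed (use assms in \<open>simp_all add: ring_of_complex_simps\<close>)

locale complex_module = Module.module "ring_of_type_algebra :: complex ring" M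
  for M :: "(complex, 'x, 'm) module_scheme" (structure)
begin

lemma scale_closed [simp, intro]: "x \<in> carrier M \<Longrightarrow> z \<odot> x \<in> carrier M"
  using smult_closed by (simp add: ring_of_complex_simps)

lemma scale_add_left: "x \<in> carrier M \<Longrightarrow> (z + w) \<odot> x = z \<odot> x \<oplus> w \<odot> x"
  using smult_l_distr by (simp add: ring_of_complex_simps)

lemma scale_add_right:
  "\<lbrakk>x \<in> carrier M; y \<in> carrier M\<rbrakk> \<Longrightarrow> z \<odot> (x \<oplus> y) = z \<odot> x \<oplus> z \<odot> y"
  using smult_r_distr by (simp add: ring_of_complex_simps)

lemma scale_scale: "x \<in> carrier M \<Longrightarrow> z \<odot> (w \<odot> x) = (z * w) \<odot> x"
  using smult_assoc1 by (simp add: ring_of_complex_simps)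

lemma scale_one [simp]: "x \<in> carrier M \<Longrightarrow> 1 \<odot> x = x"
  using smult_one by (simp add: ring_of_complex_simps)

lemma scale_zero_left [simp]: "x \<in> carrier M \<Longrightarrow> 0 \<odot> x = \<zero>"
  using smult_l_null by (simp add: ring_of_complex_simps)

lemma scale_zero_right [simp]: "z \<odot> \<zero> = \<zero>"
  using smult_r_null by (simp add: ring_of_complex_simps)

lemma uminus_eq_scale: "x \<in> carrier M \<Longrightarrow> \<ominus> x = (-1) \<odot> x"
  by (rule minus_equality) (use scale_add_left[of x "-1" 1] in auto)

lemma minus_eq_add_scale: "\<lbrakk>x \<in> carrier M; y \<in> carrier M\<rbrakk> \<Longrightarrow> x \<ominus> y = x \<oplus> (-1) \<odot> y"
  by (simp add: a_minus_def uminus_eq_scale)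

lemma add_minus_cancel_right:
  "\<lbrakk>x \<in> carrier M; y \<in> carrier M; z \<in> carrier M\<rbrakk> \<Longrightarrow> (x \<oplus> z) \<ominus> (y \<oplus> z) = x \<ominus> y"
  by (simp add: a_minus_def minus_add a_ac r_neg1 r_neg)

end

section \<open>Linear maps and linear forms\<close>

definition linear_map ::
    "(complex, 'x, 'm) module_scheme \<Rightarrow> (complex, 'y, 'n) module_scheme \<Rightarrow> ('x \<Rightarrow> 'y) \<Rightarrow> bool" where
  "linear_map M N T \<longleftrightarrow> T \<in> carrier M \<rightarrow> carrier N \<and>
     (\<forall>x\<in>carrier M. \<forall>y\<in>carrier M. T (x \<oplus>\<^bsub>M\<^esub> y) = T x \<oplus>\<^bsub>N\<^esub> T y) \<and>
     (\<forall>z. \<forall>x\<in>carrier M. T (z \<odot>\<^bsub>M\<^esub> x) = z \<odot>\<^bsub>N\<^esub> T x)"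

text \<open>Forms are kept apart from linear maps because their values lie in the type
  \<open>complex\<close> itself, not in the carrier of a module record.\<close>

definition linear_form :: "(complex, 'x, 'm) module_scheme \<Rightarrow> ('x \<Rightarrow> complex) \<Rightarrow> bool" where
  "linear_form M f \<longleftrightarrow>
     (\<forall>x\<in>carrier M. \<forall>y\<in>carrier M. f (x \<oplus>\<^bsub>M\<^esub> y) = f x + f y) \<and>
     (\<forall>z. \<forall>x\<in>carrier M. f (z \<odot>\<^bsub>M\<^esub> x) = z * f x)"

lemma linear_mapD:
  assumes "linear_map M N T"
  shows "x \<in> carrier M \<Longrightarrow> T x \<in> carrier N"
    and "\<lbrakk>x \<in> carrier M; y \<in> carrier M\<rbrakk> \<Longrightarrow> T (x \<oplus>\<^bsub>M\<^esub> y) = T x \<oplus>\<^bsub>N\<^esub> T y"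
    and "x \<in> carrier M \<Longrightarrow> T (z \<odot>\<^bsub>M\<^esub> x) = z \<odot>\<^bsub>N\<^esub> T x"
  using assms by (auto simp: linear_map_def)

lemma linear_map_minus:
  assumes "linear_map M N T" "complex_module M" "complex_module N"
    and "x \<in> carrier M" "y \<in> carrier M"
  shows "T (x \<ominus>\<^bsub>M\<^esub> y) = T x \<ominus>\<^bsub>N\<^esub> T y"
proof -
  interpret M: complex_module M by fact
  interpret N: complex_module N by fact
  show ?thesis
    using assms(4,5) linear_mapD[OF assms(1)] by (simp add: M.minus_eq_add_scale N.minus_eq_add_scale)
qed

lemma linear_formD:
  assumes "linear_form M f"
  shows "\<lbrakk>x \<in> carrier M; y \<in> carrier M\<rbrakk> \<Longrightarrow> f (x \<oplus>\<^bsub>M\<^esub> y) = f x + f y"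
    and "x \<in> carrier M \<Longrightarrow> f (z \<odot>\<^bsub>M\<^esub> x) = z * f x"
  using assms by (auto simp: linear_form_def)

lemma linear_form_minus:
  assumes "linear_form M f" "complex_module M" "x \<in> carrier M" "y \<in> carrier M"
  shows "f (x \<ominus>\<^bsub>M\<^esub> y) = f x - f y"
proof -
  interpret M: complex_module M by fact
  show ?thesis
    using assms(3,4) linear_formD[OF assms(1)] by (simp add: M.minus_eq_add_scale)
qed

lemma linear_form_comp:
  "\<lbrakk>linear_map M N T; linear_form N f\<rbrakk> \<Longrightarrow> linear_form M (\<lambda>x. f (T x))"
  by (simp add: linear_map_def linear_form_def Pi_iff)

section \<open>The topology generated by a family of seminorms\<close>

lemma topspace_lc_topology [simp]: "topspace (lc_topology M P) = carrier M"
  by (auto simp: lc_topology_def)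

locale lc_space = complex_module M
  for M :: "(complex, 'x, 'm) module_scheme" (structure) and P :: "('x \<Rightarrow> real) set" +
  assumes seminorm: "p \<in> P \<Longrightarrow> seminorm_on M p"
begin

lemma seminorm_nonneg: "\<lbrakk>p \<in> P; x \<in> carrier M\<rbrakk> \<Longrightarrow> 0 \<le> p x"
  using seminorm[of p] by (simp add: seminorm_on_def)

lemma seminorm_triangle: "\<lbrakk>p \<in> P; x \<in> carrier M; y \<in> carrier M\<rbrakk> \<Longrightarrow> p (x \<oplus> y) \<le> p x + p y"
  using seminorm[of p] by (simp add: seminorm_on_def)

lemma seminorm_scale: "\<lbrakk>p \<in> P; x \<in> carrier M\<rbrakk> \<Longrightarrow> p (z \<odot> x) = cmod z * p x"
  using seminorm[of p] by (simp add: seminorm_on_def)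

lemma seminorm_zero: "p \<in> P \<Longrightarrow> p \<zero> = 0"
  using seminorm_scale[of p \<zero> 0] by simp

lemma seminorm_minus_triangle:
  assumes "p \<in> P" "x \<in> carrier M" "y \<in> carrier M" "z \<in> carrier M"
  shows "p (x \<ominus> z) \<le> p (x \<ominus> y) + p (y \<ominus> z)"
proof -
  have "x \<ominus> z = (x \<ominus> y) \<oplus> (y \<ominus> z)"
    using assms by (simp add: a_minus_def a_ac r_neg1 r_neg2 r_neg)
  then show ?thesis
    using assms seminorm_triangle by simp
qed

lemma openin_ball:
  assumes "p \<in> P" "x \<in> carrier M"
  shows "openin (lc_topology M P) {y \<in> carrier M. p (y \<ominus> x) < r}"
proof (cases "0 < r")
  case True
  then show ?thesis
    unfolding lc_topology_def using assms by (intro topology_generated_by_Basis) auto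
next
  case False
  \<comment> \<open>For \<open>r \<le> 0\<close> the ball is empty because seminorms are
    nonnegative, which allows radii of any sign.\<close>
  have "0 \<le> p (y \<ominus> x)" if "y \<in> carrier M" for y
    using seminorm_nonneg assms that by simp
  with False have "{y \<in> carrier M. p (y \<ominus> x) < r} = {}"
    by force
  then show ?thesis by (simp only: openin_empty)
qed

text \<open>Balls of single seminorms form only a subbase, so this criterion is sufficient but not
  necessary. It fits the preimages below, each of which is controlled by one seminorm.\<close>

lemma openin_lc_topologyI:
  assumes "U \<subseteq> carrier M"
    and "\<And>x. x \<in> U \<Longrightarrow> \<exists>p\<in>P. \<exists>r>0. \<forall>y\<in>carrier M. p (y \<ominus> x) < r \<longrightarrow> y \<in> U"
  shows "openin (lc_topology M P) U"
proof (subst openin_subopen, intro ballI)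
  fix x assume x: "x \<in> U"
  then obtain p r where p: "p \<in> P" "r > 0" "\<forall>y\<in>carrier M. p (y \<ominus> x) < r \<longrightarrow> y \<in> U"
    using assms(2) by blast
  then show "\<exists>T. openin (lc_topology M P) T \<and> x \<in> T \<and> T \<subseteq> U"
    using x assms(1) openin_ball[of p x r] seminorm_zero[of p]
    by (intro exI[of _ "{y \<in> carrier M. p (y \<ominus> x) < r}"]) (auto simp: a_minus_def r_neg)
qed

text \<open>Neighbourhoods of zero absorb bounded sets. The family \<open>P\<close> need not be
  directed, so the proof follows the generation of open sets from the subbase. Asking for all
  \<open>s \<le> t\<close>, not just one scalar, is what lets intersections take the minimum of two
  thresholds.\<close>

lemma open_absorbs_bounded:
  assumes U: "openin (lc_topology M P) U" "\<zero> \<in> U" and S: "lc_bounded M P S"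
  shows "\<exists>t>0. \<forall>s. 0 < s \<and> s \<le> t \<longrightarrow> (\<forall>x\<in>S. complex_of_real s \<odot> x \<in> U)"
proof -
  let ?B = "insert (carrier M)
     {{y \<in> carrier M. p (y \<ominus> x) < r} | p x r. p \<in> P \<and> x \<in> carrier M \<and> 0 < r}"
  have SM: "S \<subseteq> carrier M" using S by (simp add: lc_bounded_def)
  have "generate_topology_on ?B U"
    using U(1) unfolding lc_topology_def by (rule openin_topology_generated_by)
  then show ?thesis
    using U(2)
  proof (induction rule: generate_topology_on.induct)
    case Empty
    then show ?case by simp
  next
    case (Int U V)
    then obtain t u where tu: "t > 0" "\<forall>s. 0 < s \<and> s \<le> t \<longrightarrow> (\<forall>x\<in>S. complex_of_real s \<odot> x \<in> U)"
      "u > 0" "\<forall>s. 0 < s \<and> s \<le> u \<longrightarrow> (\<forall>x\<in>S. complex_of_real s \<odot> x \<in> V)"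
      by auto
    then show ?case by (intro exI[of _ "min t u"]) auto
  next
    case (UN K)
    then obtain V where V: "V \<in> K" "\<zero> \<in> V" by auto
    from UN.IH[OF V] V(1) show ?case by (meson UnionI)
  next
    case (Basis V)
    then consider "V = carrier M" |
      p x r where "V = {y \<in> carrier M. p (y \<ominus> x) < r}" "p \<in> P" "x \<in> carrier M"
      by auto
    then show ?case
    proof cases
      case 1
      then show ?thesis using SM by (auto intro!: exI[of _ 1])
    next
      case 2
      \<comment> \<open>The room left around zero in a ball centred at \<open>x\<close>: by the
        triangle inequality, \<open>p y < d\<close> puts \<open>y\<close> into
        \<open>V\<close>.\<close>
      define d where "d = r - p (\<zero> \<ominus> x)"
      have d: "d > 0" using Basis.prems 2 by (simp add: d_def)
      obtain K where K: "\<And>y. y \<in> S \<Longrightarrow> p y \<le> K"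
        using S 2(2) by (metis bdd_above.unfold imageI lc_bounded_def)
      \<comment> \<open>The summand 1 keeps the denominator positive even if \<open>K\<close> is
        zero, and makes the final estimate strict.\<close>
      define t where "t = d / (\<bar>K\<bar> + 1)"
      have "complex_of_real s \<odot> y \<in> V" if s: "0 < s" "s \<le> t" and y: "y \<in> S" for s y
      proof -
        have yM: "y \<in> carrier M" using SM y by blast
        have "p (complex_of_real s \<odot> y \<ominus> x) \<le> p (complex_of_real s \<odot> y \<ominus> \<zero>) + p (\<zero> \<ominus> x)"
          using 2 yM by (intro seminorm_minus_triangle) auto
        also have "complex_of_real s \<odot> y \<ominus> \<zero> = complex_of_real s \<odot> y"
          using yM by (simp add: minus_eq_add_scale)
        also have "p \<dots> = s * p y"
          using 2 yM s by (simp add: seminorm_scale)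
        also have "s * p y < d"
        proof -
          have "s * p y \<le> s * \<bar>K\<bar>"
            using K[OF y] s by (intro mult_left_mono) auto
          also have "\<dots> < s * (\<bar>K\<bar> + 1)" using s by simp
          also have "\<dots> \<le> t * (\<bar>K\<bar> + 1)" using s by (intro mult_right_mono) auto
          also have "\<dots> = d" by (simp add: t_def add_nonneg_pos divide_simps)
          finally show ?thesis .
        qed
        finally show ?thesis using 2 yM by (simp add: d_def)
      qed
      moreover have "t > 0" using d by (simp add: t_def add_nonneg_pos)
      ultimately show ?thesis by blast
    qed
  qed
qed

text \<open>The preimage of the unit disc is an open set around zero, hence absorbs
  \<open>S\<close>; scaling back by \<open>t\<close> gives the bound \<open>1 / t\<close>. This
  makes the suprema in the strong seminorms finite.\<close>

lemma continuous_form_bounded_on: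
  assumes f: "linear_form M f" "continuous_map (lc_topology M P) euclidean f"
    and S: "lc_bounded M P S"
  shows "\<exists>K. \<forall>x\<in>S. cmod (f x) \<le> K"
proof -
  have f0: "f \<zero> = 0" using linear_formD(2)[OF f(1), of \<zero> 0] by simp
  have "openin (lc_topology M P) {x \<in> carrier M. f x \<in> ball 0 1}"
    using openin_continuous_map_preimage[OF f(2), of "ball 0 1"] by simp
  from open_absorbs_bounded[OF this _ S] f0 obtain t
    where t: "t > 0" "\<forall>x\<in>S. complex_of_real t \<odot> x \<in> {x \<in> carrier M. f x \<in> ball 0 1}"
    by auto
  have "cmod (f x) \<le> 1 / t" if x: "x \<in> S" for x
  proof -
    have "x \<in> carrier M" using S x by (auto simp: lc_bounded_def)
    then have "t * cmod (f x) < 1"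
      using t x linear_formD(2)[OF f(1), of x t] by (auto simp: norm_mult)
    then show ?thesis using t(1) by (simp add: field_simps)
  qed
  then show ?thesis by blast
qed

lemma continuous_form_bdd_above:
  assumes "linear_form M f" "continuous_map (lc_topology M P) euclidean f" "lc_bounded M P S"
  shows "bdd_above ((\<lambda>x. cmod (f x)) ` S)"
  using continuous_form_bounded_on[OF assms] by (auto simp: bdd_above_def)

lemma lc_bounded_singleton [simp]: "x \<in> carrier M \<Longrightarrow> lc_bounded M P {x}"
  by (simp add: lc_bounded_def)

end

text \<open>One seminorm of the source has to dominate each seminorm of the target. For families
  that are not directed this is stronger than continuity; it is inherited by transposes.\<close>

definition bounded_linear_map ::
    "(complex, 'x, 'm) module_scheme \<Rightarrow> ('x \<Rightarrow> real) set \<Rightarrow>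
     (complex, 'y, 'n) module_scheme \<Rightarrow> ('y \<Rightarrow> real) set \<Rightarrow> ('x \<Rightarrow> 'y) \<Rightarrow> bool" where
  "bounded_linear_map M P N Q T \<longleftrightarrow> linear_map M N T \<and>
     (\<forall>q\<in>Q. \<exists>p\<in>P. \<exists>C. \<forall>x\<in>carrier M. q (T x) \<le> C * p x)"

definition bounded_linear_form ::
    "(complex, 'x, 'm) module_scheme \<Rightarrow> ('x \<Rightarrow> real) set \<Rightarrow> ('x \<Rightarrow> complex) \<Rightarrow> bool" where
  "bounded_linear_form M P f \<longleftrightarrow> linear_form M f \<and>
     (\<exists>p\<in>P. \<exists>C. \<forall>x\<in>carrier M. cmod (f x) \<le> C * p x)"

context lc_space
begin

text \<open>A strictly positive constant can be divided by when radii of balls are chosen.\<close>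

lemma bound_pos:
  fixes C :: real
  assumes "p \<in> P" and C: "\<And>x. x \<in> carrier M \<Longrightarrow> g x \<le> C * p x"
  obtains K where "K > 0" "\<And>x. x \<in> carrier M \<Longrightarrow> g x \<le> K * p x"
proof
  show "\<bar>C\<bar> + 1 > 0" by simp
  fix x assume x: "x \<in> carrier M"
  have "C * p x \<le> (\<bar>C\<bar> + 1) * p x"
    using seminorm_nonneg[OF assms(1) x] by (intro mult_right_mono) auto
  with C[OF x] show "g x \<le> (\<bar>C\<bar> + 1) * p x" by simp
qed

text \<open>It suffices to treat preimages of subbasic balls. If \<open>T x\<close> lies in the ball
  of radius \<open>r\<close> about \<open>b\<close>, the remaining room
  \<open>r - q (T x \<ominus> b)\<close>, divided by the constant \<open>K\<close>, is a radius that
  works at \<open>x\<close>.\<close>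

lemma bounded_linear_map_continuous:
  assumes T: "bounded_linear_map M P N Q T" and N: "lc_space N Q"
  shows "continuous_map (lc_topology M P) (lc_topology N Q) T"
proof -
  interpret N: lc_space N Q by fact
  have lin: "linear_map M N T" using T by (simp add: bounded_linear_map_def)
  note lin' = linear_mapD[OF lin]
  have op: "openin (lc_topology M P) (T -` {y \<in> carrier N. q (y \<ominus>\<^bsub>N\<^esub> b) < r} \<inter> carrier M)"
    if q: "q \<in> Q" and b: "b \<in> carrier N" for q b r
  proof (rule openin_lc_topologyI)
    fix x assume "x \<in> T -` {y \<in> carrier N. q (y \<ominus>\<^bsub>N\<^esub> b) < r} \<inter> carrier M"
    then have x: "x \<in> carrier M" "q (T x \<ominus>\<^bsub>N\<^esub> b) < r" by auto
    obtain p C where p: "p \<in> P" "\<And>x. x \<in> carrier M \<Longrightarrow> q (T x) \<le> C * p x"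
      using T q unfolding bounded_linear_map_def by blast
    obtain K where K: "K > 0" "\<And>x. x \<in> carrier M \<Longrightarrow> q (T x) \<le> K * p x"
      using bound_pos[OF p(1), of "\<lambda>x. q (T x)" C] p(2) by metis
    have "q (T y \<ominus>\<^bsub>N\<^esub> b) < r"
      if y: "y \<in> carrier M" "p (y \<ominus> x) < (r - q (T x \<ominus>\<^bsub>N\<^esub> b)) / K" for y
    proof -
      have "q (T y \<ominus>\<^bsub>N\<^esub> b) \<le> q (T y \<ominus>\<^bsub>N\<^esub> T x) + q (T x \<ominus>\<^bsub>N\<^esub> b)"
        using q b x y lin' by (intro N.seminorm_minus_triangle) auto
      also have "T y \<ominus>\<^bsub>N\<^esub> T x = T (y \<ominus> x)"
        using linear_map_minus[OF lin complex_module_axioms N.complex_module_axioms] x y by simp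
      also have "q \<dots> \<le> K * p (y \<ominus> x)" using K x y by simp
      also have "\<dots> < r - q (T x \<ominus>\<^bsub>N\<^esub> b)" using y(2) K(1) by (simp add: field_simps)
      finally show ?thesis by simp
    qed
    moreover have "(r - q (T x \<ominus>\<^bsub>N\<^esub> b)) / K > 0" using x K by simp
    ultimately show "\<exists>p\<in>P. \<exists>s>0. \<forall>y\<in>carrier M. p (y \<ominus> x) < s \<longrightarrow>
        y \<in> T -` {y \<in> carrier N. q (y \<ominus>\<^bsub>N\<^esub> b) < r} \<inter> carrier M"
      using p(1) lin' by (intro bexI[of _ p] exI[of _ "(r - q (T x \<ominus>\<^bsub>N\<^esub> b)) / K"]) auto
  qed auto
  show ?thesis
    unfolding lc_topology_def[of N Q]
  proof (rule continuous_on_generated_topo)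
    fix U assume "U \<in> insert (carrier N)
      {{y \<in> carrier N. p (y \<ominus>\<^bsub>N\<^esub> x) < r} |p x r. p \<in> Q \<and> x \<in> carrier N \<and> 0 < r}"
    then consider "U = carrier N" |
      q b r where "U = {y \<in> carrier N. q (y \<ominus>\<^bsub>N\<^esub> b) < r}" "q \<in> Q" "b \<in> carrier N"
      by auto
    then show "openin (lc_topology M P) (T -` U \<inter> topspace (lc_topology M P))"
    proof cases
      case 1
      then have "T -` U \<inter> topspace (lc_topology M P) = topspace (lc_topology M P)"
        using lin' by auto
      then show ?thesis by (simp only: openin_topspace)
    next
      case 2
      then show ?thesis using op by simp
    qed
  qed (use lin' in auto)
qed

lemma bounded_linear_form_continuous:
  assumes f: "bounded_linear_form M P f"
  shows "continuous_map (lc_topology M P) euclidean f"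
  unfolding continuous_map_def
proof (intro conjI allI impI)
  fix U :: "complex set" assume "openin euclidean U"
  then have U: "open U" by simp
  have lin: "linear_form M f" using f by (simp add: bounded_linear_form_def)
  obtain p C where p: "p \<in> P" "\<And>x. x \<in> carrier M \<Longrightarrow> cmod (f x) \<le> C * p x"
    using f unfolding bounded_linear_form_def by blast
  obtain K where K: "K > 0" "\<And>x. x \<in> carrier M \<Longrightarrow> cmod (f x) \<le> K * p x"
    using bound_pos[OF p(1), of "\<lambda>x. cmod (f x)" C] p(2) by metis
  have "openin (lc_topology M P) {x \<in> carrier M. f x \<in> U}"
  proof (rule openin_lc_topologyI)
    fix x assume x: "x \<in> {x \<in> carrier M. f x \<in> U}"
    then obtain d where d: "d > 0" "ball (f x) d \<subseteq> U" using U open_contains_ball by blast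
    have "f y \<in> U" if y: "y \<in> carrier M" "p (y \<ominus> x) < d / K" for y
    proof -
      have "dist (f x) (f y) = cmod (f (y \<ominus> x))"
        using linear_form_minus[OF lin complex_module_axioms, of y x] x y
        by (simp add: dist_norm norm_minus_commute)
      also have "\<dots> \<le> K * p (y \<ominus> x)" using K x y by simp
      also have "\<dots> < d" using y(2) K(1) by (simp add: field_simps)
      finally show ?thesis using d(2) by auto
    qed
    then show "\<exists>p\<in>P. \<exists>r>0. \<forall>y\<in>carrier M. p (y \<ominus> x) < r \<longrightarrow> y \<in> {x \<in> carrier M. f x \<in> U}"
      using p(1) K(1) d(1) by (intro bexI[of _ p] exI[of _ "d / K"]) auto
  qed auto
  then show "openin (lc_topology M P) {x \<in> topspace (lc_topology M P). f x \<in> U}" by simp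
qed auto

lemma lc_bounded_image:
  assumes T: "bounded_linear_map M P N Q T" and S: "lc_bounded M P S"
  shows "lc_bounded N Q (T ` S)"
  unfolding lc_bounded_def
proof (intro conjI ballI)
  have SM: "S \<subseteq> carrier M" using S by (simp add: lc_bounded_def)
  then show "T ` S \<subseteq> carrier N"
    using T by (auto simp: bounded_linear_map_def linear_map_def)
  fix q assume "q \<in> Q"
  then obtain p C where p: "p \<in> P" "\<And>x. x \<in> carrier M \<Longrightarrow> q (T x) \<le> C * p x"
    using T unfolding bounded_linear_map_def by blast
  obtain K where K: "K > 0" "\<And>x. x \<in> carrier M \<Longrightarrow> q (T x) \<le> K * p x"
    using bound_pos[OF p(1), of "\<lambda>x. q (T x)" C] p(2) by metis
  obtain b where "\<And>x. x \<in> S \<Longrightarrow> p x \<le> b"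
    using S p(1) by (metis bdd_above.unfold imageI lc_bounded_def)
  with K SM have "q (T x) \<le> K * b" if "x \<in> S" for x
    by (meson mult_left_mono less_imp_le order_trans subsetD that)
  then show "bdd_above (q ` T ` S)" by (auto simp: bdd_above_def)
qed

end

subsection \<open>Strong duals and transposes\<close>

lemma functionals_iff:
  "f \<in> functionals E \<longleftrightarrow> f \<in> extensional (carrier E) \<and> linear_form E f \<and>
     continuous_map (bimod_topology E) euclidean f"
  by (auto simp: functionals_def linear_form_def)

text \<open>Since \<open>\<kappa>\<close> is injective on the functionals, \<open>app\<close> undoes
  it, and the coded dual can be handled like the space of functionals itself.\<close>

locale coded_dual = lc_space E "seminorms E"
  for E :: "('b, 'x) bimodule" (structure) and \<kappa> :: "('x \<Rightarrow> complex) \<Rightarrow> 'u" +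
  assumes inj: "inj_on \<kappa> (functionals E)"
begin

abbreviation app :: "'u \<Rightarrow> 'x \<Rightarrow> complex" where
  "app \<equiv> apply_code \<kappa> E"

abbreviation E' :: "('b, 'u) bimodule" where
  "E' \<equiv> dual \<kappa> E"

lemma app_code: "f \<in> functionals E \<Longrightarrow> app (\<kappa> f) = f"
  using inj by (simp add: apply_code_def)

lemma dual_carrier: "carrier E' = \<kappa> ` functionals E"
  by (simp add: dual_def)

lemma app_functional: "u \<in> carrier E' \<Longrightarrow> app u \<in> functionals E"
  by (auto simp: dual_carrier app_code)

lemma code_app: "u \<in> carrier E' \<Longrightarrow> \<kappa> (app u) = u"
  by (auto simp: dual_carrier app_code)

lemma app_linear: "u \<in> carrier E' \<Longrightarrow> linear_form E (app u)"
  using app_functional by (simp add: functionals_iff)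

lemma app_continuous: "u \<in> carrier E' \<Longrightarrow> continuous_map (bimod_topology E) euclidean (app u)"
  using app_functional by (simp add: functionals_iff)

lemma app_bdd_above:
  "\<lbrakk>u \<in> carrier E'; lc_bounded E (seminorms E) S\<rbrakk> \<Longrightarrow> bdd_above ((\<lambda>x. cmod (app u x)) ` S)"
  by (rule continuous_form_bdd_above[OF app_linear app_continuous])

text \<open>Functionals are extensional and \<open>\<kappa>\<close> recovers a code from its
  functional, so values on the carrier determine a code. Nearly all identities in duals are reduced
  to values by this rule.\<close>

lemma dual_eqI:
  assumes "u \<in> carrier E'" "v \<in> carrier E'" "\<And>x. x \<in> carrier E \<Longrightarrow> app u x = app v x"
  shows "u = v"
proof -
  have "app u = app v"
    using app_functional[OF assms(1)] app_functional[OF assms(2)] assms(3)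
    by (intro extensionalityI[where A = "carrier E"]) (auto simp: functionals_iff)
  then show ?thesis
    using code_app assms by metis
qed

lemma restrict_functional:
  assumes "linear_form E f" "continuous_map (bimod_topology E) euclidean f"
  shows "(\<lambda>x\<in>carrier E. f x) \<in> functionals E"
proof -
  have "continuous_map (bimod_topology E) euclidean (\<lambda>x\<in>carrier E. f x)"
    by (rule continuous_map_eq[OF assms(2)]) simp
  then show ?thesis
    using assms(1) by (simp add: functionals_iff linear_form_def)
qed

text \<open>The common source of elements of the dual: sums, multiples, zero, transposes and the
  coordinate functional are all codes of restricted continuous forms.\<close>

lemma code_restrict:
  assumes "linear_form E f" "continuous_map (bimod_topology E) euclidean f"
  shows "\<kappa> (\<lambda>x\<in>carrier E. f x) \<in> carrier E'"
    and "x \<in> carrier E \<Longrightarrow> app (\<kappa> (\<lambda>x\<in>carrier E. f x)) x = f x"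
  using restrict_functional[OF assms] app_code by (auto simp: dual_carrier)

lemma dual_add:
  assumes "u \<in> carrier E'" "v \<in> carrier E'"
  shows "u \<oplus>\<^bsub>E'\<^esub> v \<in> carrier E'"
    and "x \<in> carrier E \<Longrightarrow> app (u \<oplus>\<^bsub>E'\<^esub> v) x = app u x + app v x"
proof -
  have lin: "linear_form E (\<lambda>x. app u x + app v x)"
    using app_linear[OF assms(1)] app_linear[OF assms(2)]
    by (simp add: linear_form_def algebra_simps)
  have cont: "continuous_map (bimod_topology E) euclidean (\<lambda>x. app u x + app v x)"
    using app_continuous assms by (intro continuous_map_add)
  have "u \<oplus>\<^bsub>E'\<^esub> v = \<kappa> (\<lambda>x\<in>carrier E. app u x + app v x)"
    by (simp add: dual_def)
  with code_restrict[OF lin cont] show "u \<oplus>\<^bsub>E'\<^esub> v \<in> carrier E'"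
    and "x \<in> carrier E \<Longrightarrow> app (u \<oplus>\<^bsub>E'\<^esub> v) x = app u x + app v x"
    by simp_all
qed

lemma dual_zero:
  shows "\<zero>\<^bsub>E'\<^esub> \<in> carrier E'"
    and "x \<in> carrier E \<Longrightarrow> app (\<zero>\<^bsub>E'\<^esub>) x = 0"
proof -
  have lin: "linear_form E (\<lambda>x. 0)"
    by (simp add: linear_form_def)
  have "\<zero>\<^bsub>E'\<^esub> = \<kappa> (\<lambda>x\<in>carrier E. 0)"
    by (simp add: dual_def)
  with code_restrict[OF lin] show "\<zero>\<^bsub>E'\<^esub> \<in> carrier E'"
    and "x \<in> carrier E \<Longrightarrow> app (\<zero>\<^bsub>E'\<^esub>) x = 0"
    by simp_all
qed

lemma dual_scale:
  assumes "u \<in> carrier E'"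
  shows "z \<odot>\<^bsub>E'\<^esub> u \<in> carrier E'"
    and "x \<in> carrier E \<Longrightarrow> app (z \<odot>\<^bsub>E'\<^esub> u) x = z * app u x"
proof -
  have lin: "linear_form E (\<lambda>x. z * app u x)"
    using app_linear[OF assms(1)] by (simp add: linear_form_def algebra_simps)
  have "continuous_map euclidean euclidean ((*) z)"
    by (simp add: continuous_on_mult_left continuous_on_id)
  then have cont: "continuous_map (bimod_topology E) euclidean (\<lambda>x. z * app u x)"
    using continuous_map_compose[OF app_continuous[OF assms], of euclidean "(*) z"]
    by (simp add: o_def)
  have "z \<odot>\<^bsub>E'\<^esub> u = \<kappa> (\<lambda>x\<in>carrier E. z * app u x)"
    by (simp add: dual_def)
  with code_restrict[OF lin cont] show "z \<odot>\<^bsub>E'\<^esub> u \<in> carrier E'"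
    and "x \<in> carrier E \<Longrightarrow> app (z \<odot>\<^bsub>E'\<^esub> u) x = z * app u x"
    by simp_all
qed

lemma dual_complex_module: "complex_module E'"
  unfolding complex_module_def
  \<comment> \<open>The optional rule turns the equational axioms into identities between complex
    values and leaves the closure goals alone.\<close>
  by (rule complex_moduleI; (rule dual_eqI)?)
    (simp_all add: dual_add dual_zero dual_scale algebra_simps)

lemma dual_seminorm:
  assumes S: "S \<noteq> {}" "lc_bounded E (seminorms E) S"
  shows "seminorm_on E' (\<lambda>u. SUP x\<in>S. cmod (app u x))"
  unfolding seminorm_on_def
proof (intro conjI ballI allI)
  have SE: "S \<subseteq> carrier E" using S by (simp add: lc_bounded_def)
  note bdd = app_bdd_above[OF _ S(2)]
  fix u assume u: "u \<in> carrier E'"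
  obtain x where x: "x \<in> S" using S by blast
  have "cmod (app u x) \<le> (SUP x\<in>S. cmod (app u x))"
    by (rule cSUP_upper[OF x bdd[OF u]])
  then show "0 \<le> (SUP x\<in>S. cmod (app u x))"
    by (rule order_trans[OF norm_ge_zero])
  show "(SUP x\<in>S. cmod (app (u \<oplus>\<^bsub>E'\<^esub> v) x)) \<le>
      (SUP x\<in>S. cmod (app u x)) + (SUP x\<in>S. cmod (app v x))" if v: "v \<in> carrier E'" for v
  proof (rule cSUP_least[OF S(1)])
    fix x assume x: "x \<in> S"
    with SE have "cmod (app (u \<oplus>\<^bsub>E'\<^esub> v) x) \<le> cmod (app u x) + cmod (app v x)"
      by (simp add: dual_add u v norm_triangle_ineq subset_iff)
    also have "\<dots> \<le> (SUP x\<in>S. cmod (app u x)) + (SUP x\<in>S. cmod (app v x))"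
      by (intro add_mono cSUP_upper x bdd u v)
    finally show "cmod (app (u \<oplus>\<^bsub>E'\<^esub> v) x) \<le> \<dots>" .
  qed
  show "(SUP x\<in>S. cmod (app (z \<odot>\<^bsub>E'\<^esub> u) x)) = cmod z * (SUP x\<in>S. cmod (app u x))" for z
  proof -
    have "(SUP x\<in>S. cmod (app (z \<odot>\<^bsub>E'\<^esub> u) x)) = (SUP x\<in>S. cmod z * cmod (app u x))"
      using SE by (intro SUP_cong) (auto simp: dual_scale u norm_mult)
    \<comment> \<open>Multiplication by \<open>cmod z\<close> is monotone and continuous, so it
      commutes with the supremum of a nonempty set that is bounded above.\<close>
    also have "\<dots> = cmod z * (SUP x\<in>S. cmod (app u x))"
      using continuous_at_Sup_mono[of "\<lambda>t. cmod z * t" "(\<lambda>x. cmod (app u x)) ` S"] bdd[OF u] S(1)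
      by (simp add: image_comp o_def mono_def mult_left_mono continuous_at_imp_continuous_at_within)
    finally show ?thesis .
  qed
qed

lemma dual_seminorms:
  "seminorms E' = {\<lambda>u. SUP x\<in>S. cmod (app u x) | S. S \<noteq> {} \<and> lc_bounded E (seminorms E) S}"
  by (simp add: dual_def)

lemma dual_lc_space: "lc_space E' (seminorms E')"
  using dual_complex_module dual_seminorm
  by (auto simp: lc_space_def lc_space_axioms_def dual_seminorms)

text \<open>The singleton of \<open>x\<close> is bounded, and its strong seminorm is the modulus of
  the value at \<open>x\<close>. Evaluation at \<open>c\<close> thereby becomes the coordinate form
  on the dual.\<close>

lemma evaluation_bounded:
  assumes "x \<in> carrier E"
  shows "bounded_linear_form E' (seminorms E') (\<lambda>u. app u x)"
  unfolding bounded_linear_form_def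
proof
  show "linear_form E' (\<lambda>u. app u x)"
    using assms by (simp add: linear_form_def dual_add dual_scale)
  have "(\<lambda>u. SUP x\<in>{x}. cmod (app u x)) \<in> seminorms E'"
    using assms unfolding dual_seminorms by (blast intro: lc_bounded_singleton)
  then show "\<exists>p\<in>seminorms E'. \<exists>C. \<forall>u\<in>carrier E'. cmod (app u x) \<le> C * p u"
    by (intro bexI[where x = "\<lambda>u. SUP x\<in>{x}. cmod (app u x)"] exI[of _ 1]) auto
qed

end

definition transpose_map ::
    "(('x \<Rightarrow> complex) \<Rightarrow> 'u) \<Rightarrow> ('b, 'x) bimodule \<Rightarrow> (('y \<Rightarrow> complex) \<Rightarrow> 'v) \<Rightarrow> ('c, 'y) bimodule \<Rightarrow>
     ('x \<Rightarrow> 'y) \<Rightarrow> 'v \<Rightarrow> 'u" where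
  "transpose_map \<kappa> E \<eta> F T v = \<kappa> (\<lambda>x\<in>carrier E. apply_code \<eta> F v (T x))"

lemma
  assumes E: "coded_dual E \<kappa>" and F: "coded_dual F \<eta>"
    and T: "bounded_linear_map E (seminorms E) F (seminorms F) T"
  shows transpose_closed:
      "v \<in> carrier (dual \<eta> F) \<Longrightarrow> transpose_map \<kappa> E \<eta> F T v \<in> carrier (dual \<kappa> E)"
    and apply_transpose:
      "\<lbrakk>v \<in> carrier (dual \<eta> F); x \<in> carrier E\<rbrakk> \<Longrightarrow>
       apply_code \<kappa> E (transpose_map \<kappa> E \<eta> F T v) x = apply_code \<eta> F v (T x)"
    and transpose_bounded:
      "bounded_linear_map (dual \<eta> F) (seminorms (dual \<eta> F)) (dual \<kappa> E) (seminorms (dual \<kappa> E))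
         (transpose_map \<kappa> E \<eta> F T)"
proof -
  interpret E: coded_dual E \<kappa> by fact
  interpret F: coded_dual F \<eta> by fact
  let ?T' = "transpose_map \<kappa> E \<eta> F T"
  have lin: "linear_map E F T" using T by (simp add: bounded_linear_map_def)
  note TE = linear_mapD(1)[OF lin]
  have *: "?T' v \<in> carrier E.E'" "x \<in> carrier E \<Longrightarrow> E.app (?T' v) x = F.app v (T x)"
    if v: "v \<in> carrier F.E'" for v x
  proof -
    have 1: "linear_form E (\<lambda>x. F.app v (T x))"
      using linear_form_comp[OF lin F.app_linear[OF v]] .
    have 2: "continuous_map (bimod_topology E) euclidean (\<lambda>x. F.app v (T x))"
      using continuous_map_compose[OF E.bounded_linear_map_continuous[OF T F.lc_space_axioms]
          F.app_continuous[OF v]] by (simp add: o_def)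
    show "?T' v \<in> carrier E.E'" "x \<in> carrier E \<Longrightarrow> E.app (?T' v) x = F.app v (T x)"
      unfolding transpose_map_def using E.code_restrict[OF 1 2] by auto
  qed
  show "v \<in> carrier F.E' \<Longrightarrow> ?T' v \<in> carrier E.E'"
    and "\<lbrakk>v \<in> carrier F.E'; x \<in> carrier E\<rbrakk> \<Longrightarrow> E.app (?T' v) x = F.app v (T x)"
    by (rule *; assumption)+
  show "bounded_linear_map F.E' (seminorms F.E') E.E' (seminorms E.E') ?T'"
    unfolding bounded_linear_map_def linear_map_def
  proof (intro conjI ballI allI)
    show "?T' (u \<oplus>\<^bsub>F.E'\<^esub> v) = ?T' u \<oplus>\<^bsub>E.E'\<^esub> ?T' v"
      if "u \<in> carrier F.E'" "v \<in> carrier F.E'" for u v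
      using that by (intro E.dual_eqI) (simp_all add: * E.dual_add F.dual_add TE)
    show "?T' (z \<odot>\<^bsub>F.E'\<^esub> v) = z \<odot>\<^bsub>E.E'\<^esub> ?T' v" if "v \<in> carrier F.E'" for z v
      using that by (intro E.dual_eqI) (simp_all add: * E.dual_scale F.dual_scale TE)
    fix q assume "q \<in> seminorms E.E'"
    then obtain S where S: "S \<noteq> {}" "lc_bounded E (seminorms E) S"
      and q: "q = (\<lambda>u. SUP x\<in>S. cmod (E.app u x))"
      unfolding E.dual_seminorms by blast
    have SE: "x \<in> carrier E" if "x \<in> S" for x using S that by (auto simp: lc_bounded_def)
    let ?p = "\<lambda>v. SUP y\<in>T ` S. cmod (F.app v y)"
    have "?p \<in> seminorms F.E'"
      unfolding F.dual_seminorms using E.lc_bounded_image[OF T S(2)] S(1) by blast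
    moreover have "q (?T' v) = ?p v" if "v \<in> carrier F.E'" for v
      unfolding q image_comp o_def using that by (intro SUP_cong) (auto simp: * SE)
    ultimately show "\<exists>p\<in>seminorms F.E'. \<exists>C. \<forall>v\<in>carrier F.E'. q (?T' v) \<le> C * p v"
      by (intro bexI[of _ ?p] exI[of _ 1]) simp_all
  qed (use * in auto)
qed

section \<open>Continuous actions and their duals\<close>

definition lc_bimodule :: "'b set \<Rightarrow> ('b, 'x) bimodule \<Rightarrow> bool" where
  "lc_bimodule B E \<longleftrightarrow> lc_space E (seminorms E) \<and>
     (\<forall>b\<in>B. bounded_linear_map E (seminorms E) E (seminorms E) (lact E b) \<and>
            bounded_linear_map E (seminorms E) E (seminorms E) (\<lambda>x. ract E x b))"

lemma lc_bimoduleD: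
  assumes "lc_bimodule B E"
  shows "lc_space E (seminorms E)"
    and "b \<in> B \<Longrightarrow> bounded_linear_map E (seminorms E) E (seminorms E) (lact E b)"
    and "b \<in> B \<Longrightarrow> bounded_linear_map E (seminorms E) E (seminorms E) (\<lambda>x. ract E x b)"
    and "b \<in> B \<Longrightarrow> linear_map E E (lact E b)"
    and "b \<in> B \<Longrightarrow> linear_map E E (\<lambda>x. ract E x b)"
  using assms by (auto simp: lc_bimodule_def bounded_linear_map_def)

text \<open>Dualizing swaps the two sides; in this form, continuity of the dual actions is a case of
  continuity of transposes.\<close>

lemma dual_lact_eq: "lact (dual \<kappa> E) b = transpose_map \<kappa> E \<kappa> E (\<lambda>x. ract E x b)"
  and dual_ract_eq: "(\<lambda>u. ract (dual \<kappa> E) u b) = transpose_map \<kappa> E \<kappa> E (lact E b)"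
  by (simp_all add: dual_def transpose_map_def fun_eq_iff)

lemma
  assumes E: "lc_bimodule B E" and inj: "inj_on \<kappa> (functionals E)"
  shows coded_dual_if_bimodule: "coded_dual E \<kappa>"
    and dual_bimodule: "lc_bimodule B (dual \<kappa> E)"
    and apply_dual_lact: "\<lbrakk>b \<in> B; u \<in> carrier (dual \<kappa> E); x \<in> carrier E\<rbrakk> \<Longrightarrow>
      apply_code \<kappa> E (lact (dual \<kappa> E) b u) x = apply_code \<kappa> E u (ract E x b)"
    and apply_dual_ract: "\<lbrakk>b \<in> B; u \<in> carrier (dual \<kappa> E); x \<in> carrier E\<rbrakk> \<Longrightarrow>
      apply_code \<kappa> E (ract (dual \<kappa> E) u b) x = apply_code \<kappa> E u (lact E b x)"
proof -
  show c: "coded_dual E \<kappa>"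
    using lc_bimoduleD(1)[OF E] inj by (simp add: coded_dual_def coded_dual_axioms_def)
  show "lc_bimodule B (dual \<kappa> E)"
    using coded_dual.dual_lc_space[OF c] transpose_bounded[OF c c] lc_bimoduleD[OF E]
    by (simp add: lc_bimodule_def dual_lact_eq dual_ract_eq)
  show "apply_code \<kappa> E (lact (dual \<kappa> E) b u) x = apply_code \<kappa> E u (ract E x b)"
    if "b \<in> B" "u \<in> carrier (dual \<kappa> E)" "x \<in> carrier E"
    using that apply_transpose[OF c c lc_bimoduleD(3)[OF E]] by (simp add: dual_lact_eq)
  show "apply_code \<kappa> E (ract (dual \<kappa> E) u b) x = apply_code \<kappa> E u (lact E b x)"
    if "b \<in> B" "u \<in> carrier (dual \<kappa> E)" "x \<in> carrier E"
    using that apply_transpose[OF c c lc_bimoduleD(2)[OF E]] by (simp add: dual_ract_eq[THEN fun_cong])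
qed

subsection \<open>Splitting off the unit in the iterated duals\<close>

text \<open>The part of the splitting that is the same in all degrees: \<open>T\<close> embeds,
  \<open>S\<close> projects, and \<open>\<phi>\<close> is the coordinate along \<open>c\<close>.
  Later \<open>K\<close> is \<open>carrier A\<close> and \<open>\<theta>\<close> its zero, so that
  \<open>(\<theta>, 1)\<close> is the identity of the unitization.\<close>

locale linked_bimodules =
  fixes K :: "'a set" and \<theta> :: 'a
    and E :: "('a, 'x) bimodule" and F :: "('a \<times> complex, 'y) bimodule"
    and T :: "'x \<Rightarrow> 'y" and S :: "'y \<Rightarrow> 'x" and c :: 'y and \<phi> :: "'y \<Rightarrow> complex"
  assumes bimodule_E: "lc_bimodule K E"
    and bimodule_F: "lc_bimodule (K \<times> UNIV) F"
    and T_bounded: "bounded_linear_map E (seminorms E) F (seminorms F) T"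
    and S_bounded: "bounded_linear_map F (seminorms F) E (seminorms E) S"
    and \<phi>_bounded: "bounded_linear_form F (seminorms F) \<phi>"
    and c_closed: "c \<in> carrier F"
    and S_T: "x \<in> carrier E \<Longrightarrow> S (T x) = x"
    and decomposition: "y \<in> carrier F \<Longrightarrow> y = T (S y) \<oplus>\<^bsub>F\<^esub> \<phi> y \<odot>\<^bsub>F\<^esub> c"
    and lact_unital: "\<lbrakk>a \<in> K; y \<in> carrier F\<rbrakk> \<Longrightarrow>
      lact F (a, z) y = lact F (a, 0) y \<oplus>\<^bsub>F\<^esub> z \<odot>\<^bsub>F\<^esub> y"
    and ract_unital: "\<lbrakk>a \<in> K; y \<in> carrier F\<rbrakk> \<Longrightarrow>
      ract F y (a, z) = ract F y (a, 0) \<oplus>\<^bsub>F\<^esub> z \<odot>\<^bsub>F\<^esub> y"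
    and \<theta>_mem: "\<theta> \<in> K"
    and lact_one: "y \<in> carrier F \<Longrightarrow> lact F (\<theta>, 1) y = y"
    and ract_one: "y \<in> carrier F \<Longrightarrow> ract F y (\<theta>, 1) = y"
begin

sublocale E: lc_space E "seminorms E"
  using bimodule_E by (rule lc_bimoduleD)

sublocale F: lc_space F "seminorms F"
  using bimodule_F by (rule lc_bimoduleD)

lemma T_linear: "linear_map E F T" and S_linear: "linear_map F E S"
  and \<phi>_linear: "linear_form F \<phi>"
  using T_bounded S_bounded \<phi>_bounded
  by (simp_all add: bounded_linear_map_def bounded_linear_form_def)

lemmas T_closed = linear_mapD(1)[OF T_linear]
  and S_closed = linear_mapD(1)[OF S_linear]

lemma action_closed:
  assumes "a \<in> K"
  shows "x \<in> carrier E \<Longrightarrow> lact E a x \<in> carrier E"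
    and "x \<in> carrier E \<Longrightarrow> ract E x a \<in> carrier E"
    and "y \<in> carrier F \<Longrightarrow> lact F (a, z) y \<in> carrier F"
    and "y \<in> carrier F \<Longrightarrow> ract F y (a, z) \<in> carrier F"
  using linear_mapD(1)[OF lc_bimoduleD(4)[OF bimodule_E assms]]
    linear_mapD(1)[OF lc_bimoduleD(5)[OF bimodule_E assms]]
    linear_mapD(1)[OF lc_bimoduleD(4)[OF bimodule_F, of "(a, z)"]]
    linear_mapD(1)[OF lc_bimoduleD(5)[OF bimodule_F, of "(a, z)"]] assms
  by auto

end

text \<open>The even duals of the unitization are split as \<open>F = T E \<oplus> \<complex> c\<close>, where \<open>c\<close> is the unit
  and \<open>\<phi>\<close> vanishes on \<open>A \<cdot> F\<close> and \<open>F \<cdot> A\<close>. Transposition exchanges the roles of \<open>c\<close> and \<open>\<phi>\<close>,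
  and turns an even link into an odd one and conversely.\<close>

locale even_link = linked_bimodules +
  assumes T_lact: "\<lbrakk>a \<in> K; x \<in> carrier E\<rbrakk> \<Longrightarrow> T (lact E a x) = lact F (a, 0) (T x)"
    and T_ract: "\<lbrakk>a \<in> K; x \<in> carrier E\<rbrakk> \<Longrightarrow> T (ract E x a) = ract F (T x) (a, 0)"
    and c_central: "a \<in> K \<Longrightarrow> lact F (a, 0) c = ract F c (a, 0)"
    and \<phi>_lact: "\<lbrakk>a \<in> K; y \<in> carrier F\<rbrakk> \<Longrightarrow> \<phi> (lact F (a, 0) y) = 0"
    and \<phi>_ract: "\<lbrakk>a \<in> K; y \<in> carrier F\<rbrakk> \<Longrightarrow> \<phi> (ract F y (a, 0)) = 0"

locale odd_link = linked_bimodules +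
  assumes S_lact: "\<lbrakk>a \<in> K; y \<in> carrier F\<rbrakk> \<Longrightarrow> S (lact F (a, 0) y) = lact E a (S y)"
    and S_ract: "\<lbrakk>a \<in> K; y \<in> carrier F\<rbrakk> \<Longrightarrow> S (ract F y (a, 0)) = ract E (S y) a"
    and \<phi>_trace: "\<lbrakk>a \<in> K; y \<in> carrier F\<rbrakk> \<Longrightarrow> \<phi> (lact F (a, 0) y) = \<phi> (ract F y (a, 0))"
    and lact_c: "a \<in> K \<Longrightarrow> lact F (a, 0) c = \<zero>\<^bsub>F\<^esub>"
    and ract_c: "a \<in> K \<Longrightarrow> ract F c (a, 0) = \<zero>\<^bsub>F\<^esub>"

section \<open>Transposing a splitting\<close>

locale coded_link = linked_bimodules K \<theta> E F T S c \<phi>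
  for K :: "'a set" and \<theta> and E :: "('a, 'x) bimodule" and F :: "('a \<times> complex, 'y) bimodule"
    and T S c \<phi> +
  fixes \<kappa> :: "('x \<Rightarrow> complex) \<Rightarrow> 'u" and \<eta> :: "('y \<Rightarrow> complex) \<Rightarrow> 'v"
  assumes inj_\<kappa>: "inj_on \<kappa> (functionals E)" and inj_\<eta>: "inj_on \<eta> (functionals F)"
begin

sublocale CE: coded_dual E \<kappa>
  using bimodule_E inj_\<kappa> by (rule coded_dual_if_bimodule)

sublocale CF: coded_dual F \<eta>
  using bimodule_F inj_\<eta> by (rule coded_dual_if_bimodule)

text \<open>Transposition reverses arrows: the embedding of the duals comes from the projection
  \<open>S\<close>, and their projection from the embedding \<open>T\<close>.\<close>

definition T' :: "'u \<Rightarrow> 'v" where "T' = transpose_map \<eta> F \<kappa> E S"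
definition S' :: "'v \<Rightarrow> 'u" where "S' = transpose_map \<kappa> E \<eta> F T"
definition c' :: 'v where "c' = \<eta> (\<lambda>y\<in>carrier F. \<phi> y)"
definition \<phi>' :: "'v \<Rightarrow> complex" where "\<phi>' v = CF.app v c"

lemma T'_closed: "u \<in> carrier CE.E' \<Longrightarrow> T' u \<in> carrier CF.E'"
  and app_T': "\<lbrakk>u \<in> carrier CE.E'; y \<in> carrier F\<rbrakk> \<Longrightarrow> CF.app (T' u) y = CE.app u (S y)"
  and T'_bounded: "bounded_linear_map CE.E' (seminorms CE.E') CF.E' (seminorms CF.E') T'"
  unfolding T'_def
  using transpose_closed[OF CF.coded_dual_axioms CE.coded_dual_axioms S_bounded]
    apply_transpose[OF CF.coded_dual_axioms CE.coded_dual_axioms S_bounded]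
    transpose_bounded[OF CF.coded_dual_axioms CE.coded_dual_axioms S_bounded]
  by blast+

lemma S'_closed: "v \<in> carrier CF.E' \<Longrightarrow> S' v \<in> carrier CE.E'"
  and app_S': "\<lbrakk>v \<in> carrier CF.E'; x \<in> carrier E\<rbrakk> \<Longrightarrow> CE.app (S' v) x = CF.app v (T x)"
  and S'_bounded: "bounded_linear_map CF.E' (seminorms CF.E') CE.E' (seminorms CE.E') S'"
  unfolding S'_def
  using transpose_closed[OF CE.coded_dual_axioms CF.coded_dual_axioms T_bounded]
    apply_transpose[OF CE.coded_dual_axioms CF.coded_dual_axioms T_bounded]
    transpose_bounded[OF CE.coded_dual_axioms CF.coded_dual_axioms T_bounded]
  by blast+

lemma c'_closed: "c' \<in> carrier CF.E'"
  and app_c': "y \<in> carrier F \<Longrightarrow> CF.app c' y = \<phi> y"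
  unfolding c'_def
  using CF.code_restrict[OF \<phi>_linear F.bounded_linear_form_continuous[OF \<phi>_bounded]] by auto

lemmas E'_lact = apply_dual_lact[OF bimodule_E inj_\<kappa>]
  and E'_ract = apply_dual_ract[OF bimodule_E inj_\<kappa>]

lemma F'_lact: "\<lbrakk>a \<in> K; v \<in> carrier CF.E'; y \<in> carrier F\<rbrakk> \<Longrightarrow>
    CF.app (lact CF.E' (a, z) v) y = CF.app v (ract F y (a, z))"
  and F'_ract: "\<lbrakk>a \<in> K; v \<in> carrier CF.E'; y \<in> carrier F\<rbrakk> \<Longrightarrow>
    CF.app (ract CF.E' v (a, z)) y = CF.app v (lact F (a, z) y)"
  using apply_dual_lact[OF bimodule_F inj_\<eta>] apply_dual_ract[OF bimodule_F inj_\<eta>] by simp_all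

lemma dual_linked: "linked_bimodules K \<theta> CE.E' CF.E' T' S' c' \<phi>'"
proof
  show bE: "lc_bimodule K CE.E'" and bF: "lc_bimodule (K \<times> UNIV) CF.E'"
    using dual_bimodule bimodule_E bimodule_F inj_\<kappa> inj_\<eta> by blast+
  show "bounded_linear_form CF.E' (seminorms CF.E') \<phi>'"
    unfolding \<phi>'_def using c_closed by (rule CF.evaluation_bounded)
  show "S' (T' u) = u" if "u \<in> carrier CE.E'" for u
    using that by (intro CE.dual_eqI) (simp_all add: S'_closed T'_closed app_S' app_T' T_closed S_T)
  show "v = T' (S' v) \<oplus>\<^bsub>CF.E'\<^esub> \<phi>' v \<odot>\<^bsub>CF.E'\<^esub> c'" if v: "v \<in> carrier CF.E'" for v
  proof (rule CF.dual_eqI[OF v])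
    fix y assume y: "y \<in> carrier F"
    \<comment> \<open>Applying \<open>v\<close> to the splitting of \<open>y\<close> gives its dual
      splitting: the first term is the value of \<open>T' (S' v)\<close> at \<open>y\<close>, the
      second that of \<open>\<phi>' v\<close> times \<open>c'\<close>.\<close>
    have "CF.app v y = CF.app v (T (S y) \<oplus>\<^bsub>F\<^esub> \<phi> y \<odot>\<^bsub>F\<^esub> c)"
      using decomposition[OF y] by simp
    also have "\<dots> = CF.app v (T (S y)) + \<phi> y * CF.app v c"
      using linear_formD[OF CF.app_linear[OF v]] by (simp add: T_closed S_closed y c_closed)
    finally show "CF.app v y = CF.app (T' (S' v) \<oplus>\<^bsub>CF.E'\<^esub> \<phi>' v \<odot>\<^bsub>CF.E'\<^esub> c') y"
      using v y by (simp add: CF.dual_add CF.dual_scale T'_closed S'_closed c'_closed app_T' app_S'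
          app_c' S_closed \<phi>'_def)
  qed (simp add: CF.dual_add CF.dual_scale T'_closed S'_closed c'_closed v)
  have lF': "lact CF.E' (a, z) v \<in> carrier CF.E'" "ract CF.E' v (a, z) \<in> carrier CF.E'"
    if "a \<in> K" "v \<in> carrier CF.E'" for a z v
    using linear_mapD(1)[OF lc_bimoduleD(4)[OF bF, of "(a, z)"]]
      linear_mapD(1)[OF lc_bimoduleD(5)[OF bF, of "(a, z)"]] that by auto
  show "lact CF.E' (\<theta>, 1) v = v" "ract CF.E' v (\<theta>, 1) = v" if "v \<in> carrier CF.E'" for v
    using that \<theta>_mem
    by (intro CF.dual_eqI; simp add: lF' F'_lact F'_ract lact_one ract_one)+
  fix a v z assume a: "a \<in> K" and v: "v \<in> carrier CF.E'"
  note app_lin = linear_formD[OF CF.app_linear[OF v]]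
  show "lact CF.E' (a, z) v = lact CF.E' (a, 0) v \<oplus>\<^bsub>CF.E'\<^esub> z \<odot>\<^bsub>CF.E'\<^esub> v"
    using a v by (intro CF.dual_eqI)
      (simp_all add: lF' CF.dual_add CF.dual_scale F'_lact ract_unital[of a _ z] app_lin action_closed)
  show "ract CF.E' v (a, z) = ract CF.E' v (a, 0) \<oplus>\<^bsub>CF.E'\<^esub> z \<odot>\<^bsub>CF.E'\<^esub> v"
    using a v by (intro CF.dual_eqI)
      (simp_all add: lF' CF.dual_add CF.dual_scale F'_ract lact_unital[of a _ z] app_lin action_closed)
qed (fact T'_bounded S'_bounded c'_closed \<theta>_mem)+

text \<open>Evaluation turns each even condition into an odd one. As dualizing swaps sides,
  \<open>T_ract\<close> and \<open>T_lact\<close> give \<open>S_lact\<close> and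
  \<open>S_ract\<close>; centrality of \<open>c\<close> gives the trace property of
  \<open>\<phi>'\<close>; and vanishing of \<open>\<phi>\<close> on \<open>A \<cdot> F\<close> and
  \<open>F \<cdot> A\<close> says that \<open>A\<close> annihilates \<open>c'\<close>.\<close>

lemma odd_link_if_even:
  assumes "even_link K \<theta> E F T S c \<phi>"
  shows "odd_link K \<theta> CE.E' CF.E' T' S' c' \<phi>'"
proof -
  interpret even_link K \<theta> E F T S c \<phi> by fact
  interpret D: linked_bimodules K \<theta> CE.E' CF.E' T' S' c' \<phi>' by (rule dual_linked)
  show ?thesis
  proof
    fix a assume a: "a \<in> K"
    show "S' (lact CF.E' (a, 0) v) = lact CE.E' a (S' v)" if "v \<in> carrier CF.E'" for v
      using a that by (intro CE.dual_eqI) (simp_all add: S'_closed D.action_closed app_S' E'_lact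
          F'_lact action_closed T_closed T_ract)
    show "S' (ract CF.E' v (a, 0)) = ract CE.E' (S' v) a" if "v \<in> carrier CF.E'" for v
      using a that by (intro CE.dual_eqI) (simp_all add: S'_closed D.action_closed app_S' E'_ract
          F'_ract action_closed T_closed T_lact)
    show "\<phi>' (lact CF.E' (a, 0) v) = \<phi>' (ract CF.E' v (a, 0))" if "v \<in> carrier CF.E'" for v
      using a that by (simp add: \<phi>'_def F'_lact F'_ract c_closed c_central)
    show "lact CF.E' (a, 0) c' = \<zero>\<^bsub>CF.E'\<^esub>" "ract CF.E' c' (a, 0) = \<zero>\<^bsub>CF.E'\<^esub>"
      using a by (intro CF.dual_eqI; simp add: D.action_closed c'_closed CF.dual_zero F'_lact F'_ract
          app_c' action_closed \<phi>_lact \<phi>_ract)+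
  qed
qed

text \<open>The same dictionary backwards: the trace property of \<open>\<phi>\<close> makes
  \<open>c'\<close> central, and since \<open>A\<close> annihilates \<open>c\<close>, evaluation at
  \<open>c\<close> vanishes on the dual actions of \<open>A\<close>.\<close>

lemma even_link_if_odd:
  assumes "odd_link K \<theta> E F T S c \<phi>"
  shows "even_link K \<theta> CE.E' CF.E' T' S' c' \<phi>'"
proof -
  interpret odd_link K \<theta> E F T S c \<phi> by fact
  interpret D: linked_bimodules K \<theta> CE.E' CF.E' T' S' c' \<phi>' by (rule dual_linked)
  show ?thesis
  proof
    fix a assume a: "a \<in> K"
    show "T' (lact CE.E' a u) = lact CF.E' (a, 0) (T' u)" if "u \<in> carrier CE.E'" for u
      using a that by (intro CF.dual_eqI) (simp_all add: T'_closed D.action_closed app_T' E'_lact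
          F'_lact action_closed S_closed S_ract)
    show "T' (ract CE.E' u a) = ract CF.E' (T' u) (a, 0)" if "u \<in> carrier CE.E'" for u
      using a that by (intro CF.dual_eqI) (simp_all add: T'_closed D.action_closed app_T' E'_ract
          F'_ract action_closed S_closed S_lact)
    show "lact CF.E' (a, 0) c' = ract CF.E' c' (a, 0)"
      using a by (intro CF.dual_eqI) (simp_all add: D.action_closed c'_closed F'_lact F'_ract
          app_c' action_closed \<phi>_trace)
    fix v assume v: "v \<in> carrier CF.E'"
    have "CF.app v \<zero>\<^bsub>F\<^esub> = 0"
      using linear_formD(2)[OF CF.app_linear[OF v], of "\<zero>\<^bsub>F\<^esub>" 0] by simp
    then show "\<phi>' (lact CF.E' (a, 0) v) = 0" "\<phi>' (ract CF.E' v (a, 0)) = 0"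
      using a v by (simp_all add: \<phi>'_def F'_lact F'_ract c_closed lact_c ract_c)
  qed
qed

end

text \<open>Two transpositions lead from even to odd and back to even. The maps are hidden behind an
  existential so that the lemma can be iterated.\<close>

lemma even_link_dual_dual:
  fixes \<kappa> :: "('x \<Rightarrow> complex) \<Rightarrow> 'u" and \<eta> :: "('y \<Rightarrow> complex) \<Rightarrow> 'v"
    and \<kappa>' :: "('u \<Rightarrow> complex) \<Rightarrow> 'u'" and \<eta>' :: "('v \<Rightarrow> complex) \<Rightarrow> 'v'"
  assumes "even_link K \<theta> E F T S c \<phi>"
    and "inj_on \<kappa> (functionals E)" "inj_on \<eta> (functionals F)"
    and "inj_on \<kappa>' (functionals (dual \<kappa> E))" "inj_on \<eta>' (functionals (dual \<eta> F))"
  shows "\<exists>T S c \<phi>. even_link K \<theta> (dual \<kappa>' (dual \<kappa> E)) (dual \<eta>' (dual \<eta> F)) T S c \<phi>"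
proof -
  interpret L: coded_link K \<theta> E F T S c \<phi> \<kappa> \<eta>
    using assms by (simp add: coded_link_def coded_link_axioms_def even_link_def)
  have odd: "odd_link K \<theta> (dual \<kappa> E) (dual \<eta> F) L.T' L.S' L.c' L.\<phi>'"
    using L.odd_link_if_even[OF assms(1)] .
  interpret L': coded_link K \<theta> "dual \<kappa> E" "dual \<eta> F" L.T' L.S' L.c' L.\<phi>' \<kappa>' \<eta>'
    using odd assms by (simp add: coded_link_def coded_link_axioms_def odd_link_def)
  show ?thesis using L'.even_link_if_odd[OF odd] by blast
qed

subsection \<open>The unitization\<close>

lemma self_bimodule_simps [simp]:
  "carrier (self_bimodule B) = carrier B"
  "\<zero>\<^bsub>self_bimodule B\<^esub> = \<zero>\<^bsub>B\<^esub>"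
  "x \<oplus>\<^bsub>self_bimodule B\<^esub> y = x \<oplus>\<^bsub>B\<^esub> y"
  "z \<odot>\<^bsub>self_bimodule B\<^esub> x = z \<odot>\<^bsub>B\<^esub> x"
  "seminorms (self_bimodule B) = range (pnorm B)"
  "lact (self_bimodule B) b x = b \<otimes>\<^bsub>B\<^esub> x"
  "ract (self_bimodule B) x b = x \<otimes>\<^bsub>B\<^esub> b"
  by (simp_all add: self_bimodule_def)

lemma unitization_simps [simp]:
  "carrier (unitization A) = carrier A \<times> UNIV"
  "\<zero>\<^bsub>unitization A\<^esub> = (\<zero>\<^bsub>A\<^esub>, 0)"
  "(a, z) \<oplus>\<^bsub>unitization A\<^esub> (b, w) = (a \<oplus>\<^bsub>A\<^esub> b, z + w)"
  "u \<odot>\<^bsub>unitization A\<^esub> (a, z) = (u \<odot>\<^bsub>A\<^esub> a, u * z)"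
  "(a, z) \<otimes>\<^bsub>unitization A\<^esub> (b, w) =
     ((a \<otimes>\<^bsub>A\<^esub> b) \<oplus>\<^bsub>A\<^esub> (w \<odot>\<^bsub>A\<^esub> a) \<oplus>\<^bsub>A\<^esub> (z \<odot>\<^bsub>A\<^esub> b), z * w)"
  "pnorm (unitization A) l (a, z) = pnorm A l a + cmod z"
  by (simp_all add: unitization_def)

lemma self_bimodule_lc_space:
  assumes "lc_space B (range (pnorm B))"
  shows "lc_space (self_bimodule B) (range (pnorm B))"
proof -
  interpret B: lc_space B "range (pnorm B)" by fact
  have "complex_module (self_bimodule B)"
    unfolding complex_module_def
  proof (rule complex_moduleI, goal_cases)
    \<comment> \<open>Goal 6 is the inverse law, where \<open>(-1) \<odot> x\<close> is read as the
      negative of \<open>x\<close> in \<open>B\<close>.\<close>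
    case (6 x)
    then show ?case by (simp add: B.uminus_eq_scale[symmetric] B.l_neg)
  qed (simp_all add: B.a_ac B.scale_add_left B.scale_add_right B.scale_scale)
  with B.seminorm show ?thesis
    by (auto simp: lc_space_def lc_space_axioms_def seminorm_on_def)
qed

context frechet_algebra
begin

sublocale lc_space A "range (pnorm A)"
  using pnorm_seminorm by unfold_locales auto

lemma mult_zero_left: "a \<in> carrier A \<Longrightarrow> \<zero> \<otimes> a = \<zero>"
  using mult_smult_left[of \<zero> a 0] by (simp add: mult_closed)

lemma mult_zero_right: "a \<in> carrier A \<Longrightarrow> a \<otimes> \<zero> = \<zero>"
  using mult_smult_right[of a \<zero> 0] by (simp add: mult_closed)

lemma unitization_lc_space: "lc_space (unitization A) (range (pnorm (unitization A)))"
proof -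
  have "complex_module (unitization A)"
    unfolding complex_module_def
  proof (rule complex_moduleI, goal_cases)
    case (6 x)
    then show ?case by (auto simp: uminus_eq_scale[symmetric] l_neg)
  qed (auto simp: a_ac scale_add_left scale_add_right scale_scale algebra_simps)
  moreover have "seminorm_on (unitization A) (pnorm (unitization A) l)" for l
    unfolding seminorm_on_def
  proof (intro conjI ballI allI)
    fix x y assume "x \<in> carrier (unitization A)" "y \<in> carrier (unitization A)"
    moreover obtain a z b w where "x = (a, z)" "y = (b, w)" by fastforce
    ultimately show "pnorm (unitization A) l (x \<oplus>\<^bsub>unitization A\<^esub> y)
        \<le> pnorm (unitization A) l x + pnorm (unitization A) l y"
      using seminorm_triangle[of "pnorm A l" a b] norm_triangle_ineq[of z w] by simp
  qed (auto simp: seminorm_nonneg seminorm_scale norm_mult algebra_simps)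
  ultimately show ?thesis
    by (auto simp: lc_space_def lc_space_axioms_def)
qed

lemma self_bimodule_is_bimodule: "lc_bimodule (carrier A) (self_bimodule A)"
  unfolding lc_bimodule_def
proof (intro conjI ballI)
  show "lc_space (self_bimodule A) (seminorms (self_bimodule A))"
    using self_bimodule_lc_space[OF lc_space_axioms] by simp
  fix b assume b: "b \<in> carrier A"
  have "\<exists>p\<in>range (pnorm A). \<exists>C. \<forall>x\<in>carrier A. pnorm A l (b \<otimes> x) \<le> C * p x" for l
    using pnorm_submultiplicative[OF b, of _ l]
    by (intro bexI[of _ "pnorm A l"] exI[of _ "pnorm A l b"]) auto
  then show "bounded_linear_map (self_bimodule A) (seminorms (self_bimodule A))
      (self_bimodule A) (seminorms (self_bimodule A)) (lact (self_bimodule A) b)"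
    using b by (auto simp: bounded_linear_map_def linear_map_def mult_closed mult_add_right
        mult_smult_right)
  have "\<exists>p\<in>range (pnorm A). \<exists>C. \<forall>x\<in>carrier A. pnorm A l (x \<otimes> b) \<le> C * p x" for l
    using pnorm_submultiplicative[OF _ b, of _ l]
    by (intro bexI[of _ "pnorm A l"] exI[of _ "pnorm A l b"]) (auto simp: mult.commute)
  then show "bounded_linear_map (self_bimodule A) (seminorms (self_bimodule A))
      (self_bimodule A) (seminorms (self_bimodule A)) (\<lambda>x. ract (self_bimodule A) x b)"
    using b by (auto simp: bounded_linear_map_def linear_map_def mult_closed mult_add_left
        mult_smult_left)
qed

text \<open>Expanding \<open>(p a + cmod z) * (p b + cmod w)\<close> yields exactly the bounds for
  the three summands of the first component, and the modulus of \<open>z * w\<close>.\<close>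

lemma unitization_pnorm_submultiplicative:
  assumes "a \<in> carrier A" "b \<in> carrier A"
  shows "pnorm (unitization A) l ((a, z) \<otimes>\<^bsub>unitization A\<^esub> (b, w))
    \<le> pnorm (unitization A) l (a, z) * pnorm (unitization A) l (b, w)"
proof -
  have "pnorm A l (a \<otimes> b \<oplus> w \<odot> a \<oplus> z \<odot> b) \<le>
      pnorm A l (a \<otimes> b) + pnorm A l (w \<odot> a) + pnorm A l (z \<odot> b)"
    using seminorm_triangle[of "pnorm A l" "a \<otimes> b \<oplus> w \<odot> a" "z \<odot> b"]
      seminorm_triangle[of "pnorm A l" "a \<otimes> b" "w \<odot> a"] assms mult_closed by simp
  also have "\<dots> \<le> pnorm A l a * pnorm A l b + cmod w * pnorm A l a + cmod z * pnorm A l b"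
    using pnorm_submultiplicative[OF assms, of l] assms by (simp add: seminorm_scale)
  finally show ?thesis
    by (simp add: norm_mult algebra_simps)
qed

lemma unitization_bimodule:
  "lc_bimodule (carrier A \<times> UNIV) (self_bimodule (unitization A))"
  unfolding lc_bimodule_def
proof (intro conjI ballI)
  let ?B = "unitization A"
  show "lc_space (self_bimodule ?B) (seminorms (self_bimodule ?B))"
    using self_bimodule_lc_space[OF unitization_lc_space] by simp
  fix b assume b: "b \<in> carrier A \<times> (UNIV :: complex set)"
  have "\<exists>p\<in>range (pnorm ?B). \<exists>C. \<forall>x\<in>carrier ?B. pnorm ?B l (b \<otimes>\<^bsub>?B\<^esub> x) \<le> C * p x" for l
    using unitization_pnorm_submultiplicative b
    by (intro bexI[of _ "pnorm ?B l"] exI[of _ "pnorm ?B l b"]) auto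
  moreover have "linear_map ?B ?B ((\<otimes>\<^bsub>?B\<^esub>) b)"
    using b by (auto simp: linear_map_def mult_closed mult_add_right mult_smult_right
        scale_add_left scale_add_right scale_scale a_ac algebra_simps)
  ultimately show "bounded_linear_map (self_bimodule ?B) (seminorms (self_bimodule ?B))
      (self_bimodule ?B) (seminorms (self_bimodule ?B)) (lact (self_bimodule ?B) b)"
    by (simp add: bounded_linear_map_def linear_map_def Pi_iff del: unitization_simps)
  have "\<exists>p\<in>range (pnorm ?B). \<exists>C. \<forall>x\<in>carrier ?B. pnorm ?B l (x \<otimes>\<^bsub>?B\<^esub> b) \<le> C * p x" for l
  proof (intro bexI[of _ "pnorm ?B l"] exI[of _ "pnorm ?B l b"] ballI)
    fix x assume "x \<in> carrier ?B"
    then show "pnorm ?B l (x \<otimes>\<^bsub>?B\<^esub> b) \<le> pnorm ?B l b * pnorm ?B l x"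
      using unitization_pnorm_submultiplicative[of "fst x" "fst b" l "snd x" "snd b"] b
      by (simp add: mult.commute mem_Times_iff del: unitization_simps(5,6))
  qed simp
  moreover have "linear_map ?B ?B (\<lambda>x. x \<otimes>\<^bsub>?B\<^esub> b)"
    using b by (auto simp: linear_map_def mult_closed mult_add_left mult_smult_left
        scale_add_left scale_add_right scale_scale a_ac algebra_simps)
  ultimately show "bounded_linear_map (self_bimodule ?B) (seminorms (self_bimodule ?B))
      (self_bimodule ?B) (seminorms (self_bimodule ?B)) (\<lambda>x. ract (self_bimodule ?B) x b)"
    by (simp add: bounded_linear_map_def linear_map_def Pi_iff del: unitization_simps)
qed

lemma inclusion_bounded:
  "bounded_linear_map A (range (pnorm A)) (unitization A) (range (pnorm (unitization A)))
     (\<lambda>a. (a, 0))"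
proof -
  have "\<exists>p\<in>range (pnorm A). \<exists>C. \<forall>a\<in>carrier A. pnorm (unitization A) l (a, 0) \<le> C * p a" for l
    by (intro bexI[of _ "pnorm A l"] exI[of _ 1]) auto
  then show ?thesis
    by (auto simp: bounded_linear_map_def linear_map_def)
qed

lemma projection_bounded:
  "bounded_linear_map (unitization A) (range (pnorm (unitization A))) A (range (pnorm A)) fst"
proof -
  have "\<exists>q\<in>range (pnorm (unitization A)). \<exists>C. \<forall>x\<in>carrier (unitization A).
      pnorm A l (fst x) \<le> C * q x" for l
    by (intro bexI[of _ "pnorm (unitization A) l"] exI[of _ 1]) auto
  then show ?thesis
    by (auto simp: bounded_linear_map_def linear_map_def)
qed

text \<open>Degree zero of the induction. Since \<open>A\<close> is a two-sided ideal of the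
  unitization, products with elements of \<open>A\<close> have scalar part zero, and the identity
  \<open>(\<zero>, 1)\<close> commutes with everything.\<close>

lemma even_link_self_bimodule:
  "even_link (carrier A) \<zero> (self_bimodule A) (self_bimodule (unitization A))
     (\<lambda>a. (a, 0)) fst (\<zero>, 1) snd"
proof
  show "lc_bimodule (carrier A) (self_bimodule A)"
    by (rule self_bimodule_is_bimodule)
  show "lc_bimodule (carrier A \<times> UNIV) (self_bimodule (unitization A))"
    by (rule unitization_bimodule)
  show "bounded_linear_map (self_bimodule A) (seminorms (self_bimodule A))
     (self_bimodule (unitization A)) (seminorms (self_bimodule (unitization A))) (\<lambda>a. (a, 0))"
    using inclusion_bounded by (simp add: bounded_linear_map_def linear_map_def)
  show "bounded_linear_map (self_bimodule (unitization A)) (seminorms (self_bimodule (unitization A)))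
     (self_bimodule A) (seminorms (self_bimodule A)) fst"
    using projection_bounded by (simp add: bounded_linear_map_def linear_map_def)
  show "bounded_linear_form (self_bimodule (unitization A))
     (seminorms (self_bimodule (unitization A))) snd"
    by (auto simp: bounded_linear_form_def linear_form_def seminorm_nonneg intro!: exI[of _ 1])
qed (auto simp: mult_closed mult_zero_left mult_zero_right a_ac)

end

section \<open>Limits along the approximate identity\<close>

lemma net_filter_not_bot:
  assumes "directed_set I R"
  shows "net_filter I R \<noteq> bot"
proof -
  \<comment> \<open>By directedness and transitivity the tails form a filter base, so a trivial
    filter would have an empty tail; but by reflexivity each index lies in its own tail.\<close>
  have "eventually P (net_filter I R) \<longleftrightarrow> (\<exists>i\<in>I. eventually P (principal {j \<in> I. R i j}))" for P
    unfolding net_filter_def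
  proof (rule eventually_INF_base)
    show "I \<noteq> {}" using assms by (simp add: directed_set_def)
    fix i j assume ij: "i \<in> I" "j \<in> I"
    then obtain k where k: "k \<in> I" "R i k" "R j k"
      using assms by (auto simp: directed_set_def)
    moreover have "transp_on I R" using assms by (simp add: directed_set_def)
    ultimately have "{l \<in> I. R k l} \<subseteq> {l \<in> I. R i l} \<inter> {l \<in> I. R j l}"
      using ij by (auto dest: transp_onD)
    then show "\<exists>k\<in>I. principal {l \<in> I. R k l} \<le>
        inf (principal {l \<in> I. R i l}) (principal {l \<in> I. R j l})"
      using k(1) by auto
  qed
  moreover have "R i i" if "i \<in> I" for i
    using assms that by (auto simp: directed_set_def dest: reflp_onD)
  ultimately show ?thesis
    by (auto simp: trivial_limit_def eventually_principal)
qed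

lemma eventually_net_filter: "I \<noteq> {} \<Longrightarrow> eventually (\<lambda>i. i \<in> I) (net_filter I R)"
  unfolding net_filter_def by (auto simp: eventually_principal intro: eventually_INF1)

text \<open>Continuity makes \<open>f a\<close> the limit of the values
  \<open>f (a \<otimes> e i)\<close>, all of which are zero for \<open>i\<close> in
  \<open>I\<close>, and limits along a proper filter are unique.\<close>

lemma (in frechet_algebra) vanishes_if_vanishes_on_products:
  assumes e: "bounded_approximate_identity A I R e"
    and f: "continuous_map (lc_topology A (range (pnorm A))) euclidean (f :: 'a \<Rightarrow> complex)"
    and f0: "\<And>a b. \<lbrakk>a \<in> carrier A; b \<in> carrier A\<rbrakk> \<Longrightarrow> f (a \<otimes> b) = 0"
    and a: "a \<in> carrier A"
  shows "f a = 0"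
proof -
  have I: "directed_set I R" and eI: "\<And>i. i \<in> I \<Longrightarrow> e i \<in> carrier A"
    and lim: "limitin (lc_topology A (range (pnorm A))) (\<lambda>i. a \<otimes> e i) a (net_filter I R)"
    using e a by (auto simp: bounded_approximate_identity_def lc_bounded_def)
  have "I \<noteq> {}" using I by (simp add: directed_set_def)
  have "((\<lambda>i. f (a \<otimes> e i)) \<longlongrightarrow> f a) (net_filter I R)"
    using continuous_map_limit[OF f lim] by (simp add: o_def)
  moreover have "((\<lambda>i. f (a \<otimes> e i)) \<longlongrightarrow> 0) (net_filter I R)"
  proof (rule tendsto_eventually)
    show "\<forall>\<^sub>F i in net_filter I R. f (a \<otimes> e i) = 0"
      using eventually_net_filter[OF \<open>I \<noteq> {}\<close>] by (rule eventually_mono) (simp add: f0 a eI)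
  qed
  ultimately show ?thesis
    using tendsto_unique net_filter_not_bot[OF I] by blast
qed

section \<open>Derivations of the algebra and of its unitization\<close>

lemma continuous_derivationD:
  assumes "continuous_derivation B E D"
  shows "a \<in> carrier B \<Longrightarrow> D a \<in> carrier E"
    and "\<lbrakk>a \<in> carrier B; b \<in> carrier B\<rbrakk> \<Longrightarrow> D (a \<oplus>\<^bsub>B\<^esub> b) = D a \<oplus>\<^bsub>E\<^esub> D b"
    and "a \<in> carrier B \<Longrightarrow> D (z \<odot>\<^bsub>B\<^esub> a) = z \<odot>\<^bsub>E\<^esub> D a"
    and "continuous_map (lc_topology B (range (pnorm B))) (bimod_topology E) D"
    and "\<lbrakk>a \<in> carrier B; b \<in> carrier B\<rbrakk> \<Longrightarrow> D (a \<otimes>\<^bsub>B\<^esub> b) = lact E a (D b) \<oplus>\<^bsub>E\<^esub> ract E (D a) b"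
  using assms by (auto simp: continuous_derivation_def)

text \<open>Here \<open>E\<close> and \<open>F\<close> stand for the duals of degree
  \<open>2 * n\<close>. Only the even link between them enters, so the comparison of derivations
  does not mention \<open>n\<close>.\<close>

locale linked_algebra =
  frechet_algebra A + even_link "carrier A" "\<zero>\<^bsub>A\<^esub>" E F T S c \<phi>
  for A :: "'a frechet" (structure) and E :: "('a, 'x) bimodule"
    and F :: "('a \<times> complex, 'y) bimodule" and T S c \<phi>
begin

abbreviation (input) B :: "('a \<times> complex) frechet" where
  "B \<equiv> unitization A"

lemma inclusion_continuous:
  "continuous_map (lc_topology A (range (pnorm A))) (lc_topology B (range (pnorm B))) (\<lambda>a. (a, 0))"
  by (rule bounded_linear_map_continuous[OF inclusion_bounded unitization_lc_space])

lemma projection_continuous: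
  "continuous_map (lc_topology B (range (pnorm B))) (lc_topology A (range (pnorm A))) fst"
  by (rule lc_space.bounded_linear_map_continuous[OF unitization_lc_space projection_bounded
        lc_space_axioms])

lemma T_continuous: "continuous_map (bimod_topology E) (bimod_topology F) T"
  by (rule E.bounded_linear_map_continuous[OF T_bounded F.lc_space_axioms])

lemma S_continuous: "continuous_map (bimod_topology F) (bimod_topology E) S"
  by (rule F.bounded_linear_map_continuous[OF S_bounded E.lc_space_axioms])

lemma T_minus: "\<lbrakk>x \<in> carrier E; y \<in> carrier E\<rbrakk> \<Longrightarrow> T (x \<ominus>\<^bsub>E\<^esub> y) = T x \<ominus>\<^bsub>F\<^esub> T y"
  by (rule linear_map_minus[OF T_linear E.complex_module_axioms F.complex_module_axioms])

text \<open>In the product rule, the mixed terms \<open>w \<odot> d a\<close> and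
  \<open>z \<odot> d b\<close> are precisely what the scalar parts of the two factors contribute to
  the actions on the values of the extension.\<close>

lemma extend_derivation:
  assumes d: "continuous_derivation A E d"
  shows "continuous_derivation B F (\<lambda>x. T (d (fst x)))"
  unfolding continuous_derivation_def
proof (intro conjI ballI allI)
  note dD = continuous_derivationD[OF d] and TD = linear_mapD[OF T_linear]
  let ?D = "\<lambda>x. T (d (fst x))"
  show "continuous_map (lc_topology B (range (pnorm B))) (bimod_topology F) ?D"
    using continuous_map_compose[OF continuous_map_compose[OF projection_continuous dD(4)]
        T_continuous] by (simp add: o_def)
  show "?D \<in> carrier B \<rightarrow> carrier F" using dD(1) TD(1) by auto
  fix x assume x: "x \<in> carrier B"
  show "?D (z \<odot>\<^bsub>B\<^esub> x) = z \<odot>\<^bsub>F\<^esub> ?D x" for z using x dD TD by auto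
  fix y assume y: "y \<in> carrier B"
  show "?D (x \<oplus>\<^bsub>B\<^esub> y) = ?D x \<oplus>\<^bsub>F\<^esub> ?D y" using x y dD TD by auto
  obtain a z b w where xy: "x = (a, z)" "y = (b, w)" "a \<in> carrier A" "b \<in> carrier A"
    using x y by (cases x, cases y) auto
  have "d (a \<otimes> b \<oplus> w \<odot> a \<oplus> z \<odot> b) =
      lact E a (d b) \<oplus>\<^bsub>E\<^esub> ract E (d a) b \<oplus>\<^bsub>E\<^esub> w \<odot>\<^bsub>E\<^esub> d a \<oplus>\<^bsub>E\<^esub> z \<odot>\<^bsub>E\<^esub> d b"
    using xy by (simp add: dD mult_closed)
  then have "?D (x \<otimes>\<^bsub>B\<^esub> y) =
      lact F (a, 0) (T (d b)) \<oplus>\<^bsub>F\<^esub> ract F (T (d a)) (b, 0) \<oplus>\<^bsub>F\<^esub> w \<odot>\<^bsub>F\<^esub> T (d a) \<oplus>\<^bsub>F\<^esub> z \<odot>\<^bsub>F\<^esub> T (d b)"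
    using xy by (simp add: TD dD action_closed T_lact T_ract)
  also have "\<dots> = (lact F (a, 0) (T (d b)) \<oplus>\<^bsub>F\<^esub> z \<odot>\<^bsub>F\<^esub> T (d b)) \<oplus>\<^bsub>F\<^esub>
      (ract F (T (d a)) (b, 0) \<oplus>\<^bsub>F\<^esub> w \<odot>\<^bsub>F\<^esub> T (d a))"
    using xy by (simp add: TD dD action_closed F.a_ac)
  finally show "?D (x \<otimes>\<^bsub>B\<^esub> y) = lact F x (?D y) \<oplus>\<^bsub>F\<^esub> ract F (?D x) y"
    using xy lact_unital[of a "T (d b)" z] ract_unital[of b "T (d a)" w] by (simp add: TD dD)
qed

text \<open>Split \<open>y\<close> into \<open>T (S y)\<close> and a multiple of \<open>c\<close>.
  The embedding respects the actions of \<open>A\<close>, and the contribution of \<open>c\<close>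
  cancels because \<open>c\<close> is central.\<close>

lemma commutator_eq:
  assumes "a \<in> carrier A" "y \<in> carrier F"
  shows "lact F (a, 0) y \<ominus>\<^bsub>F\<^esub> ract F y (a, 0) = T (lact E a (S y) \<ominus>\<^bsub>E\<^esub> ract E (S y) a)"
proof -
  note L = linear_mapD[OF lc_bimoduleD(4)[OF bimodule_F, of "(a, 0)"]]
    and R = linear_mapD[OF lc_bimoduleD(5)[OF bimodule_F, of "(a, 0)"]]
  have "lact F (a, 0) y = lact F (a, 0) (T (S y) \<oplus>\<^bsub>F\<^esub> \<phi> y \<odot>\<^bsub>F\<^esub> c)"
    using decomposition assms by metis
  \<comment> \<open>Centrality is used to write the last summand with the right action, so that it
    agrees with that of the next computation.\<close>
  also have "\<dots> = T (lact E a (S y)) \<oplus>\<^bsub>F\<^esub> \<phi> y \<odot>\<^bsub>F\<^esub> ract F c (a, 0)"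
    using assms by (simp add: L T_closed S_closed c_closed T_lact c_central)
  finally have l: "lact F (a, 0) y = \<dots>" .
  have "ract F y (a, 0) = ract F (T (S y) \<oplus>\<^bsub>F\<^esub> \<phi> y \<odot>\<^bsub>F\<^esub> c) (a, 0)"
    using decomposition assms by metis
  also have "\<dots> = T (ract E (S y) a) \<oplus>\<^bsub>F\<^esub> \<phi> y \<odot>\<^bsub>F\<^esub> ract F c (a, 0)"
    using assms by (simp add: R T_closed S_closed c_closed T_ract)
  finally show ?thesis
    using l assms by (simp add: F.add_minus_cancel_right T_closed S_closed action_closed c_closed T_minus)
qed

text \<open>If \<open>y\<close> implements the extension, then \<open>S y\<close> implements
  \<open>d\<close>: both sides agree after applying \<open>T\<close>, and \<open>T\<close> is
  injective with left inverse \<open>S\<close>.\<close>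

lemma inner_if_extension_inner:
  assumes d: "continuous_derivation A E d" and inner: "inner_derivation B F (\<lambda>x. T (d (fst x)))"
  shows "inner_derivation A E d"
proof -
  obtain y where y: "y \<in> carrier F"
    "\<forall>x\<in>carrier B. T (d (fst x)) = lact F x y \<ominus>\<^bsub>F\<^esub> ract F y x"
    using inner by (auto simp: inner_derivation_def)
  have "d a = lact E a (S y) \<ominus>\<^bsub>E\<^esub> ract E (S y) a" if a: "a \<in> carrier A" for a
  proof -
    have "T (d a) = T (lact E a (S y) \<ominus>\<^bsub>E\<^esub> ract E (S y) a)"
      using y a commutator_eq[OF a y(1)] by force
    then have "S (T (d a)) = S (T (lact E a (S y) \<ominus>\<^bsub>E\<^esub> ract E (S y) a))" by simp
    then show ?thesis
      using a y(1) continuous_derivationD(1)[OF d] by (simp add: S_T action_closed S_closed)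
  qed
  then show ?thesis
    using S_closed[OF y(1)] by (auto simp: inner_derivation_def)
qed

text \<open>Both claims rest on two facts: \<open>D\<close> kills the identity of the unitization,
  and its values have no component along \<open>c\<close>.\<close>

lemma
  assumes D: "continuous_derivation B F D" and e: "bounded_approximate_identity A I R e"
  shows derivation_eq_extension: "x \<in> carrier B \<Longrightarrow> D x = T (S (D (fst x, 0)))"
    and restrict_derivation: "continuous_derivation A E (\<lambda>a. S (D (a, 0)))"
proof -
  note DD = continuous_derivationD[OF D]
    and TD = linear_mapD[OF T_linear] and SD = linear_mapD[OF S_linear]
    and \<phi>D = linear_formD[OF \<phi>_linear]
  have Dc: "D (a, z) \<in> carrier F" if "a \<in> carrier A" for a z
    using DD(1)[of "(a, z)"] that by simp
  have cont: "continuous_map (lc_topology A (range (pnorm A))) (bimod_topology F) (\<lambda>a. D (a, 0))"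
    using continuous_map_compose[OF inclusion_continuous DD(4)] by (simp add: o_def)
  have D_one: "D (\<zero>, 1) = \<zero>\<^bsub>F\<^esub>"
  proof -
    \<comment> \<open>The product rule for the square of the identity, which acts trivially on both
      sides.\<close>
    have "D (\<zero>, 1) = D (\<zero>, 1) \<oplus>\<^bsub>F\<^esub> D (\<zero>, 1)"
      using DD(5)[of "(\<zero>, 1)" "(\<zero>, 1)"] by (simp add: lact_one ract_one Dc mult_zero_left)
    then show ?thesis
      using F.add.l_cancel_one'[of "D (\<zero>, 1)" "D (\<zero>, 1)"] Dc by simp
  qed
  have D_fst: "D (a, z) = D (a, 0)" if "a \<in> carrier A" for a z
    using DD(2)[of "(a, 0)" "z \<odot>\<^bsub>B\<^esub> (\<zero>, 1)"] DD(3)[of "(\<zero>, 1)" z] D_one that Dc by simp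
  have D_mult: "D (a \<otimes> b, 0) = lact F (a, 0) (D (b, 0)) \<oplus>\<^bsub>F\<^esub> ract F (D (a, 0)) (b, 0)"
    if "a \<in> carrier A" "b \<in> carrier A" for a b
    using DD(5)[of "(a, 0)" "(b, 0)"] that by (simp add: mult_closed)
  \<comment> \<open>On a product, \<open>D\<close> takes a value in the sum of
    \<open>A \<cdot> F\<close> and \<open>F \<cdot> A\<close>, where \<open>\<phi>\<close> vanishes;
    the approximate identity extends this to all of \<open>A\<close>.\<close>
  have "\<phi> (D (a, 0)) = 0" if "a \<in> carrier A" for a
  proof (rule vanishes_if_vanishes_on_products[OF e _ _ that])
    show "continuous_map (lc_topology A (range (pnorm A))) euclidean (\<lambda>a. \<phi> (D (a, 0)))"
      using continuous_map_compose[OF cont F.bounded_linear_form_continuous[OF \<phi>_bounded]]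
      by (simp add: o_def)
    show "\<phi> (D (a \<otimes> b, 0)) = 0" if "a \<in> carrier A" "b \<in> carrier A" for a b
      using that by (simp add: D_mult \<phi>D action_closed Dc \<phi>_lact \<phi>_ract)
  qed
  then have D_eq: "T (S (D (a, 0))) = D (a, 0)" if "a \<in> carrier A" for a
    using decomposition[OF Dc[OF that], of 0, symmetric] that
    by (simp add: Dc T_closed S_closed c_closed)
  then show "D x = T (S (D (fst x, 0)))" if "x \<in> carrier B"
    using that D_fst[of "fst x" "snd x"] by auto
  show "continuous_derivation A E (\<lambda>a. S (D (a, 0)))"
    unfolding continuous_derivation_def
  proof (intro conjI ballI allI)
    show "continuous_map (lc_topology A (range (pnorm A))) (bimod_topology E) (\<lambda>a. S (D (a, 0)))"
      using continuous_map_compose[OF cont S_continuous] by (simp add: o_def)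
    show "(\<lambda>a. S (D (a, 0))) \<in> carrier A \<rightarrow> carrier E" using Dc SD(1) by auto
    fix a assume a: "a \<in> carrier A"
    show "S (D (z \<odot> a, 0)) = z \<odot>\<^bsub>E\<^esub> S (D (a, 0))" for z
      using DD(3)[of "(a, 0)" z] a Dc SD(3) by simp
    fix b assume b: "b \<in> carrier A"
    show "S (D (a \<oplus> b, 0)) = S (D (a, 0)) \<oplus>\<^bsub>E\<^esub> S (D (b, 0))"
      using DD(2)[of "(a, 0)" "(b, 0)"] a b Dc SD(2) by simp
    \<comment> \<open>The product rule is first derived inside the range of \<open>T\<close>, where
      the actions on \<open>F\<close> are those on \<open>E\<close>; applying \<open>S\<close> then
      removes \<open>T\<close>.\<close>
    have "D (a \<otimes> b, 0) =
        lact F (a, 0) (T (S (D (b, 0)))) \<oplus>\<^bsub>F\<^esub> ract F (T (S (D (a, 0)))) (b, 0)"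
      using D_mult[OF a b] D_eq a b by simp
    also have "\<dots> = T (lact E a (S (D (b, 0))) \<oplus>\<^bsub>E\<^esub> ract E (S (D (a, 0))) b)"
      using a b by (simp add: T_lact[symmetric] T_ract[symmetric] TD action_closed S_closed Dc)
    finally show "S (D (a \<otimes> b, 0)) =
        lact E a (S (D (b, 0))) \<oplus>\<^bsub>E\<^esub> ract E (S (D (a, 0))) b"
      using a b by (simp add: S_T action_closed S_closed Dc)
  qed
qed

text \<open>If \<open>x\<close> implements \<open>d\<close>, then \<open>T x\<close> implements
  \<open>D\<close>: the scalar part \<open>z\<close> adds the same multiple of \<open>T x\<close> to
  both actions and drops out of their difference.\<close>

lemma extension_inner:
  assumes D: "\<And>x. x \<in> carrier B \<Longrightarrow> D x = T (d (fst x))" and d: "inner_derivation A E d"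
  shows "inner_derivation B F D"
proof -
  obtain x where x: "x \<in> carrier E" "\<forall>a\<in>carrier A. d a = lact E a x \<ominus>\<^bsub>E\<^esub> ract E x a"
    using d by (auto simp: inner_derivation_def)
  have "D (a, z) = lact F (a, z) (T x) \<ominus>\<^bsub>F\<^esub> ract F (T x) (a, z)" if a: "a \<in> carrier A" for a z
  proof -
    have "lact F (a, z) (T x) \<ominus>\<^bsub>F\<^esub> ract F (T x) (a, z) =
        lact F (a, 0) (T x) \<ominus>\<^bsub>F\<^esub> ract F (T x) (a, 0)"
      using lact_unital[of a "T x" z] ract_unital[of a "T x" z] a x(1)
      by (simp add: F.add_minus_cancel_right T_closed action_closed)
    also have "\<dots> = T (d a)"
      using commutator_eq[of a "T x"] a x by (simp add: T_closed S_T)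
    finally show ?thesis using D[of "(a, z)"] a by simp
  qed
  then show ?thesis
    using T_closed[OF x(1)] by (auto simp: inner_derivation_def)
qed

lemma derivations_inner_iff:
  assumes "bounded_approximate_identity A I R e"
  shows "(\<forall>D. continuous_derivation B F D \<longrightarrow> inner_derivation B F D) \<longleftrightarrow>
    (\<forall>d. continuous_derivation A E d \<longrightarrow> inner_derivation A E d)"
proof (intro iffI allI impI)
  fix d assume "\<forall>D. continuous_derivation B F D \<longrightarrow> inner_derivation B F D"
    and d: "continuous_derivation A E d"
  then show "inner_derivation A E d"
    using inner_if_extension_inner extend_derivation by blast
next
  fix D assume *: "\<forall>d. continuous_derivation A E d \<longrightarrow> inner_derivation A E d"
    and D: "continuous_derivation B F D"
  show "inner_derivation B F D"
    using derivation_eq_extension[OF D assms] *[rule_format, OF restrict_derivation[OF D assms]]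
    by (rule extension_inner)
qed

end

section \<open>Induction over the even duals\<close>

lemma even_link_nth_dual:
  assumes "even_link K \<theta> E F T S c \<phi>"
    and "n \<ge> 1" "codes_duals \<kappa>\<^sub>0 \<kappa> E (2 * n)" "codes_duals \<eta>\<^sub>0 \<eta> F (2 * n)"
  shows "\<exists>T S c \<phi>. even_link K \<theta> (nth_dual \<kappa>\<^sub>0 \<kappa> E (2 * n)) (nth_dual \<eta>\<^sub>0 \<eta> F (2 * n)) T S c \<phi>"
  using assms(2-)
proof (induction n rule: dec_induct)
  case base
  \<comment> \<open>The induction starts at the second dual: the first dual is coded by
    \<open>\<kappa>\<^sub>0\<close>, the second by \<open>\<kappa> 1\<close>.\<close>
  have "inj_on \<kappa>\<^sub>0 (functionals E)" "inj_on (\<kappa> 1) (functionals (dual \<kappa>\<^sub>0 E))"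
    "inj_on \<eta>\<^sub>0 (functionals F)" "inj_on (\<eta> 1) (functionals (dual \<eta>\<^sub>0 F))"
    using base by (auto simp: codes_duals_def dest: spec[of _ 1])
  then show ?case
    using even_link_dual_dual[OF assms(1)] by (simp add: numeral_2_eq_2)
next
  case (step n)
  have "codes_duals \<kappa>\<^sub>0 \<kappa> E (2 * n)" "codes_duals \<eta>\<^sub>0 \<eta> F (2 * n)"
    using step.prems by (auto simp: codes_duals_def)
  then obtain T S c \<phi> where
    link: "even_link K \<theta> (nth_dual \<kappa>\<^sub>0 \<kappa> E (2 * n)) (nth_dual \<eta>\<^sub>0 \<eta> F (2 * n)) T S c \<phi>"
    using step.IH by blast
  \<comment> \<open>Writing \<open>2 * n\<close> as a successor lets the equations of
    \<open>nth_dual\<close> unfold twice. The codings used are those with indices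
    \<open>2 * n\<close> and \<open>2 * n + 1\<close>, both below \<open>2 * Suc n\<close>.\<close>
  obtain m where m: "2 * n = Suc m" using step.hyps by (cases n) auto
  have "inj_on (\<kappa> (Suc m)) (functionals (nth_dual \<kappa>\<^sub>0 \<kappa> E (Suc m)))"
    "inj_on (\<eta> (Suc m)) (functionals (nth_dual \<eta>\<^sub>0 \<eta> F (Suc m)))"
    "inj_on (\<kappa> (Suc (Suc m))) (functionals (nth_dual \<kappa>\<^sub>0 \<kappa> E (Suc (Suc m))))"
    "inj_on (\<eta> (Suc (Suc m))) (functionals (nth_dual \<eta>\<^sub>0 \<eta> F (Suc (Suc m))))"
    using step.prems m unfolding codes_duals_def by auto
  then show ?case
    using even_link_dual_dual[OF link] m by simp
qed

theorem corollary3p17: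
  fixes A :: "'a frechet"
    and I :: "'i set" and R :: "'i \<Rightarrow> 'i \<Rightarrow> bool" and e :: "'i \<Rightarrow> 'a"
    and n :: nat
    and \<kappa>\<^sub>0 :: "('a \<Rightarrow> complex) \<Rightarrow> 'u" and \<kappa> :: "nat \<Rightarrow> ('u \<Rightarrow> complex) \<Rightarrow> 'u"
    and \<eta>\<^sub>0 :: "('a \<times> complex \<Rightarrow> complex) \<Rightarrow> 'v" and \<eta> :: "nat \<Rightarrow> ('v \<Rightarrow> complex) \<Rightarrow> 'v"
  assumes "frechet_algebra A"
    and "bounded_approximate_identity A I R e"
    and "n \<ge> 1"
    and "codes_duals \<kappa>\<^sub>0 \<kappa> (self_bimodule A) (2 * n)"
    and "codes_duals \<eta>\<^sub>0 \<eta> (self_bimodule (unitization A)) (2 * n)"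
  shows "n_weakly_amenable \<eta>\<^sub>0 \<eta> (2 * n) (unitization A) \<longleftrightarrow>
         n_weakly_amenable \<kappa>\<^sub>0 \<kappa> (2 * n) A"
proof -
  interpret A: frechet_algebra A by fact
  obtain T S c \<phi> where "even_link (carrier A) \<zero>\<^bsub>A\<^esub> (nth_dual \<kappa>\<^sub>0 \<kappa> (self_bimodule A) (2 * n))
      (nth_dual \<eta>\<^sub>0 \<eta> (self_bimodule (unitization A)) (2 * n)) T S c \<phi>"
    using even_link_nth_dual[OF A.even_link_self_bimodule assms(3-5)] by blast
  then interpret linked_algebra A "nth_dual \<kappa>\<^sub>0 \<kappa> (self_bimodule A) (2 * n)"
      "nth_dual \<eta>\<^sub>0 \<eta> (self_bimodule (unitization A)) (2 * n)" T S c \<phi>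
    using assms(1) by (simp add: linked_algebra_def)
  show ?thesis
    using derivations_inner_iff[OF assms(2)] by (simp add: n_weakly_amenable_def)
qed

end
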